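(* Let $\nu_u$ be a centered free Gibbs measure with potential $u:\mathbb{R}\to\mathbb{R}$ of class $\mathcal{C}^2$ such that, for some $\epsilon>0$, the function $x\mapsto u(x)-\frac{\epsilon}{2}x^2$ is convex. Let $\varphi$ be the free moment map of $\nu_u$. If $\varphi$ is $\mathcal{C}^3$, then the free moment Stein kernel of $\nu_u$ is uniformly bounded: $$\sup_{(x,y)\in\mathbb{R}^2}\left|\mathscr{J}\varphi'\big((\varphi^* )'(x),(\varphi^* )'(y)\big)\right|\le\epsilon^{-1}.$$
   Context: For a $\mathcal{C}^1$ function $f$ on $\mathbb{R}$, the free difference quotient is $\mathscr{J}f(x,y)=\frac{f(x)-f(y)}{x-y}$ if $x\neq y$ and $\mathscr{J}f(x,x)=f'(x)$. Free Gibbs measure: for a convex function $v:\mathbb{R}\to\mathbb{R}$, the free Gibbs measure $\nu_v$ is the unique minimizer, over Borel probability measures $\rho$ on $\mathbb{R}$, of $-\iint\log|t-s|\,d\rho(t)\,d\rho(s)+\int v(s)\,d\rho(s)$. It is centered if $\int x\,d\nu_v(x)=0$. Free moment map: for a centered probability measure $\mu\neq\delta_0$ on $\mathbb{R}$ with finite second moment, the free moment map of $\mu$ is the convex lower semicontinuous function $\varphi$ (considered up to translations) such that $\mu=(\varphi')_\sharp\nu_\varphi$, where $\nu_\varphi$ is the free Gibbs measure associated with $\varphi$. The Legendre transform is $\varphi^*(y)=\sup_x\{xy-\varphi(x)\}$, with $(\varphi^* )'=(\varphi')^{-1}$. The free moment Stein kernel of $\mu$ is the function $(x,y)\mapsto\mathscr{J}\varphi'((\varphi^*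 )'(x),(\varphi^* )'(y))$.
   Formalization: The supremum is taken over pairs of points in the support of ν_u, not all of ℝ²; off the support φ is not determined, and for u = x²/2 the moment map φ = x²/2 + ((x−2)₊)⁴/4 makes the supremum over ℝ² infinite. *)

theory Defs
  imports "HOL-Probability.Probability"
begin

definition C_k :: "nat \<Rightarrow> (real \<Rightarrow> real) \<Rightarrow> bool" where
  "C_k k f \<longleftrightarrow>
     (\<forall>j<k. \<forall>x. (deriv ^^ j) f differentiable (at x)) \<and> continuous_on UNIV ((deriv ^^ k) f)"

definition free_diff_quotient :: "(real \<Rightarrow> real) \<Rightarrow> real \<Rightarrow> real \<Rightarrow> real" where
  "free_diff_quotient f x y = (if x = y then deriv f x else (f x - f y) / (x - y))"

definition borel_prob :: "real measure \<Rightarrow> bool" where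
  "borel_prob \<rho> \<longleftrightarrow> prob_space \<rho> \<and> sets \<rho> = sets borel"

definition centered :: "real measure \<Rightarrow> bool" where
  "centered \<rho> \<longleftrightarrow> integrable \<rho> (\<lambda>x. x) \<and> (\<integral>x. x \<partial>\<rho>) = 0"

text \<open>
  The energy below takes values in the extended reals (the logarithmic part is infinite for
  measures with atoms), so integrals are positive part minus negative part; the Bochner integral
  would return 0 for a non-integrable integrand. In \<^typ>\<open>ereal\<close>, infinity minus infinity
  is infinity, so a measure whose energy is not well defined never competes as a minimizer.
\<close>

definition ext_integral :: "'a measure \<Rightarrow> ('a \<Rightarrow> ereal) \<Rightarrow> ereal" where
  "ext_integral M f =
     enn2ereal (\<integral>\<^sup>+x. e2ennreal (f x) \<partial>M) - enn2ereal (\<integral>\<^sup>+x. e2ennreal (- f x) \<partial>M)"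

text \<open>The case split is needed because \<^prop>\<open>ln 0 = (0::real)\<close> in HOL.\<close>

definition neg_log_dist :: "real \<Rightarrow> real \<Rightarrow> ereal" where
  "neg_log_dist t s = (if t = s then \<infinity> else ereal (- ln \<bar>t - s\<bar>))"

definition free_energy :: "(real \<Rightarrow> real) \<Rightarrow> real measure \<Rightarrow> ereal" where
  "free_energy v \<rho> =
     ext_integral (\<rho> \<Otimes>\<^sub>M \<rho>) (\<lambda>(t, s). neg_log_dist t s) + ext_integral \<rho> (\<lambda>s. ereal (v s))"

definition is_free_gibbs :: "(real \<Rightarrow> real) \<Rightarrow> real measure \<Rightarrow> bool" where
  "is_free_gibbs v \<nu> \<longleftrightarrow>
     borel_prob \<nu> \<and>
     (\<forall>\<rho>. borel_prob \<rho> \<longrightarrow> free_energy v \<nu> \<le> free_energy v \<rho>) \<and>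
     (\<forall>\<rho>. borel_prob \<rho> \<and> free_energy v \<rho> \<le> free_energy v \<nu> \<longrightarrow> \<rho> = \<nu>)"

text \<open>
  A relation rather than a function, since the moment map is only considered up to translations;
  closed sublevel sets express lower semicontinuity.
\<close>

definition is_free_moment_map :: "real measure \<Rightarrow> (real \<Rightarrow> real) \<Rightarrow> bool" where
  "is_free_moment_map \<mu> \<phi> \<longleftrightarrow>
     convex_on UNIV \<phi> \<and> (\<forall>c. closed {x. \<phi> x \<le> c}) \<and>
     (\<exists>\<nu>. is_free_gibbs \<phi> \<nu> \<and> distr \<nu> borel (deriv \<phi>) = \<mu>)"

definition legendre :: "(real \<Rightarrow> real) \<Rightarrow> real \<Rightarrow> ereal" where
  "legendre \<phi> y = (SUP x. ereal (x * y - \<phi> x))"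

definition legendre_deriv :: "(real \<Rightarrow> real) \<Rightarrow> real \<Rightarrow> real" where
  "legendre_deriv \<phi> y = deriv (\<lambda>z. real_of_ereal (legendre \<phi> z)) y"

definition free_moment_stein_kernel :: "(real \<Rightarrow> real) \<Rightarrow> real \<Rightarrow> real \<Rightarrow> real" where
  "free_moment_stein_kernel \<phi> x y =
     free_diff_quotient (deriv \<phi>) (legendre_deriv \<phi> x) (legendre_deriv \<phi> y)"

text \<open>
  The equation \<open>\<mu> = (\<phi>')\<^sub>\<sharp> \<nu>\<^sub>\<phi>\<close> determines \<open>\<phi>\<close>, up to translations and additive constants, only
  on the support of \<open>\<nu>\<^sub>\<phi>\<close>, hence the Stein kernel of \<open>\<mu>\<close> only on pairs of points of the
  support of \<open>\<mu>\<close>. For instance \<open>x^2/2\<close> and \<open>x^2/2 + (max 0 (x - 2))^4/4\<close> are both moment maps of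
  the semicircle law on \<open>[-2, 2]\<close>, but the kernel of the second is unbounded off that interval.
\<close>

definition measure_support :: "real measure \<Rightarrow> real set" where
  "measure_support \<mu> = {x. \<forall>U. open U \<and> x \<in> U \<longrightarrow> emeasure \<mu> U > 0}"

end

theory Submission
  imports Defs
begin

text \<open>
  Write \<open>T = \<phi>'\<close> and let \<open>\<eta>\<close> be the free Gibbs measure of \<open>\<phi>\<close>, so that \<open>\<nu>\<close> is the image of \<open>\<eta>\<close> under \<open>T\<close>. As
  the derivative of the Legendre transform of \<open>\<phi>\<close> inverts \<open>T\<close>, the kernel at \<open>(T x, T y)\<close> is the slope of \<open>T\<close> between \<open>x\<close> and \<open>y\<close>. The
  claim is thus that \<open>T\<close> is \<open>1 / \<epsilon>\<close>-Lipschitz on the support of \<open>\<eta>\<close>, a free analogue of Caffarelli's contraction theorem.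

  Both measures are critical for their energies, which for a test function \<open>\<psi>\<close> means, formally,
  \<open>\<integral> T \<psi> d\<eta> = \<integral>\<integral> (\<psi> x - \<psi> s) / (x - s)\<close> and \<open>\<integral> u'(T) \<psi> d\<eta> = \<integral>\<integral> (\<psi> x - \<psi> s) / (T x - T s)\<close>, where the double
  integrals are with respect to \<open>\<eta> \<otimes> \<eta>\<close>. Fix \<open>M > 1 / \<epsilon>\<close>, and let \<open>a(x, y)\<close> be antisymmetric and,
  for \<open>x > y\<close>, a truncation of the positive part of \<open>(T x - T y) - M (x - y)\<close>. For \<open>\<psi> x = \<integral> a(x, y) d\<eta>(y)\<close> the two
  equations give
  \<open>\<integral> (u'(T) - T / M) \<psi> d\<eta> = \<integral>\<integral> (\<psi> x - \<psi> s) (1 / (T x - T s) - 1 / (M (x - s)))\<close>.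
  The right side is an integral over three points, and its symmetrization is nonpositive pointwise
  (\<open>three_point_inequality\<close>). The left side is half the integral of the increments of \<open>u'(T) - T / M\<close> against
  \<open>a\<close>; since \<open>u'(y) - y / M\<close> is strictly increasing, it is positive unless \<open>a = 0\<close> almost everywhere. So
  \<open>T\<close> is \<open>M\<close>-Lipschitz on the support (\<open>comonotone_comparison\<close>).

  Only inequalities are used from the two equations, and the signs match: \<open>\<psi>\<close> has slopes bounded below with respect
  to \<open>x\<close> and above with respect to \<open>T x\<close>, which is what makes the corresponding
  perturbations of the two minimizers admissible (\<open>free_gibbs_first_variation\<close>). Compact supports keep the perturbed potential energies under control; they are obtained by
  comparing a minimizer with its restriction to a large interval (\<open>free_gibbs_bounded_support\<close>).

  Exchanging the roles of \<open>x\<close> and \<open>T x\<close> in the comparison bounds the slopes of \<open>T\<close> below by a positive constant, because \<open>u'\<close>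
  is Lipschitz on bounded sets. Hence \<open>\<phi>'' > 0\<close> on the support of \<open>\<eta>\<close>, and the Legendre transform is differentiable where the
  kernel evaluates its derivative (\<open>legendre_deriv_at_deriv\<close>).
\<close>

section \<open>Energies as Bochner integrals\<close>

lemma pair_coordinate_integrals:
  fixes f :: "'a \<Rightarrow> real"
  assumes "prob_space M" and f: "integrable M f"
  shows "integrable (M \<Otimes>\<^sub>M M) (\<lambda>p. f (fst p))" "integrable (M \<Otimes>\<^sub>M M) (\<lambda>p. f (snd p))"
    "(\<integral>p. f (fst p) \<partial>(M \<Otimes>\<^sub>M M)) = integral\<^sup>L M f" "(\<integral>p. f (snd p) \<partial>(M \<Otimes>\<^sub>M M)) = integral\<^sup>L M f"
proof -
  interpret prob_space M by fact
  interpret P: pair_sigma_finite M M ..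
  have [measurable]: "f \<in> borel_measurable M" using f by simp
  have d: "distr (M \<Otimes>\<^sub>M M) M fst = M" by (rule distr_pair_fst)
  show 1: "integrable (M \<Otimes>\<^sub>M M) (\<lambda>p. f (fst p))"
    using f by (subst integrable_distr_eq[of fst _ M, symmetric]) (simp_all add: d)
  show 2: "(\<integral>p. f (fst p) \<partial>(M \<Otimes>\<^sub>M M)) = integral\<^sup>L M f"
    by (subst integral_distr[of fst _ M, symmetric]) (simp_all add: d)
  show "integrable (M \<Otimes>\<^sub>M M) (\<lambda>p. f (snd p))"
    using P.integrable_product_swap[OF 1] by (simp add: case_prod_beta')
  show "(\<integral>p. f (snd p) \<partial>(M \<Otimes>\<^sub>M M)) = integral\<^sup>L M f"
    using P.integral_product_swap[of "\<lambda>p. f (fst p)"] 2 by (simp add: case_prod_beta')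
qed

text \<open>
  Together with the next lemma this removes extended integrals: a finite energy has finite
  positive parts, a linear lower bound on the potential controls the negative parts, and from
  then on every integral is an ordinary Bochner integral.
\<close>

lemma ext_integral_eq_integral:
  assumes f: "integrable M f" and g: "AE x in M. g x = ereal (f x)"
  shows "ext_integral M g = ereal (integral\<^sup>L M f)"
proof -
  have p: "(\<integral>\<^sup>+x. e2ennreal (g x) \<partial>M) = (\<integral>\<^sup>+x. ennreal (f x) \<partial>M)"
    using g by (intro nn_integral_cong_AE) auto
  have n: "(\<integral>\<^sup>+x. e2ennreal (- g x) \<partial>M) = (\<integral>\<^sup>+x. ennreal (- f x) \<partial>M)"
    using g by (intro nn_integral_cong_AE) auto
  obtain a where a: "0 \<le> a" "(\<integral>\<^sup>+x. ennreal (f x) \<partial>M) = ennreal a"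
    using f by (cases "\<integral>\<^sup>+x. ennreal (f x) \<partial>M") (auto simp: real_integrable_def)
  obtain b where b: "0 \<le> b" "(\<integral>\<^sup>+x. ennreal (- f x) \<partial>M) = ennreal b"
    using f by (cases "\<integral>\<^sup>+x. ennreal (- f x) \<partial>M") (auto simp: real_integrable_def)
  show ?thesis
    unfolding ext_integral_def p n real_lebesgue_integral_def[OF f] using a b by simp
qed

text \<open>
  Since \<open>\<infinity> - \<infinity> = \<infinity>\<close> in the extended reals, an infinite positive part cannot be compensated.
\<close>

lemma positive_part_finite_of_ext_integral:
  assumes "ext_integral M g < \<infinity>"
  shows "(\<integral>\<^sup>+x. e2ennreal (g x) \<partial>M) < \<infinity>"
proof (rule ccontr)
  assume "\<not> ?thesis"
  hence "(\<integral>\<^sup>+x. e2ennreal (g x) \<partial>M) = \<infinity>" by (simp add: less_top[symmetric])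
  then have "ext_integral M g = \<infinity>" by (simp add: ext_integral_def)
  with assms show False by simp
qed

lemma integrable_of_positive_part:
  fixes f g :: "'a \<Rightarrow> real"
  assumes [measurable]: "f \<in> borel_measurable M"
    and f: "(\<integral>\<^sup>+x. ennreal (f x) \<partial>M) < \<infinity>"
    and g: "integrable M g" and fg: "AE x in M. - g x \<le> f x"
  shows "integrable M f"
proof -
  have [measurable]: "g \<in> borel_measurable M" using g by simp
  have "(\<integral>\<^sup>+x. ennreal (f x + g x) \<partial>M) \<le> (\<integral>\<^sup>+x. ennreal (f x) + ennreal (g x) \<partial>M)"
  proof (intro nn_integral_mono)
    fix x
    have "ennreal (f x + g x) \<le> ennreal (max 0 (f x) + max 0 (g x))" by (intro ennreal_leI) auto
    also have "\<dots> = ennreal (f x) + ennreal (g x)" by (simp add: ennreal_plus ennreal_max_0)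
    finally show "ennreal (f x + g x) \<le> ennreal (f x) + ennreal (g x)" .
  qed
  also have "\<dots> = (\<integral>\<^sup>+x. ennreal (f x) \<partial>M) + (\<integral>\<^sup>+x. ennreal (g x) \<partial>M)"
    by (rule nn_integral_add) auto
  also have "\<dots> < \<infinity>" using f g by (auto simp: real_integrable_def less_top)
  finally have "integrable M (\<lambda>x. f x + g x)"
    using fg by (intro integrableI_nonneg) (auto elim: AE_mp)
  from Bochner_Integration.integrable_diff[OF this g] show ?thesis by simp
qed

text \<open>
  On the diagonal this takes the value \<open>0\<close> instead of \<open>\<infinity>\<close>. Measures of finite energy do not charge
  the diagonal, so the real-valued kernel computes their energy.
\<close>

definition log_kernel :: "real \<times> real \<Rightarrow> real" where
  "log_kernel p = - ln \<bar>fst p - snd p\<bar>"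

lemma measurable_log_kernel [measurable]: "log_kernel \<in> borel_measurable (borel \<Otimes>\<^sub>M borel)"
  unfolding log_kernel_def by measurable

lemma neg_log_dist_off_diagonal:
  "t \<noteq> s \<Longrightarrow> neg_log_dist t s = ereal (log_kernel (t, s))"
  by (simp add: neg_log_dist_def log_kernel_def)

lemma free_energy_eq_integrals:
  assumes "integrable (\<rho> \<Otimes>\<^sub>M \<rho>) log_kernel" "AE p in \<rho> \<Otimes>\<^sub>M \<rho>. fst p \<noteq> snd p" "integrable \<rho> v"
  shows "free_energy v \<rho> = ereal ((\<integral>p. log_kernel p \<partial>(\<rho> \<Otimes>\<^sub>M \<rho>)) + (\<integral>x. v x \<partial>\<rho>))"
proof -
  have "AE p in \<rho> \<Otimes>\<^sub>M \<rho>. (case p of (t, s) \<Rightarrow> neg_log_dist t s) = ereal (log_kernel p)"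
    using assms(2) by eventually_elim (auto simp: neg_log_dist_off_diagonal)
  from ext_integral_eq_integral[OF assms(1) this]
    ext_integral_eq_integral[OF assms(3), of "\<lambda>s. ereal (v s)"]
  show ?thesis by (simp add: free_energy_def)
qed

text \<open>
  The logarithmic energy has an infinite integrand on the diagonal, so its positive part is finite
  only if the diagonal is a null set; in particular a measure of finite energy has no atoms.
\<close>

lemma finite_free_energy_parts:
  assumes "borel_prob \<rho>" and fin: "free_energy v \<rho> < \<infinity>"
  shows "AE p in \<rho> \<Otimes>\<^sub>M \<rho>. fst p \<noteq> snd p"
    "(\<integral>\<^sup>+p. ennreal (log_kernel p) \<partial>(\<rho> \<Otimes>\<^sub>M \<rho>)) < \<infinity>"
    "(\<integral>\<^sup>+s. ennreal (v s) \<partial>\<rho>) < \<infinity>"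
proof -
  have sb: "sets \<rho> = sets borel" using assms(1) by (simp add: borel_prob_def)
  have [measurable_cong]: "sets \<rho> = sets borel" by fact
  let ?L = "ext_integral (\<rho> \<Otimes>\<^sub>M \<rho>) (\<lambda>(t, s). neg_log_dist t s)"
  let ?V = "ext_integral \<rho> (\<lambda>s. ereal (v s))"
  have L: "?L < \<infinity>" and V: "?V < \<infinity>"
    using fin by (auto simp: free_energy_def)
  show "(\<integral>\<^sup>+s. ennreal (v s) \<partial>\<rho>) < \<infinity>"
    using positive_part_finite_of_ext_integral[OF V] by simp
  have A: "(\<integral>\<^sup>+p. e2ennreal (case p of (t, s) \<Rightarrow> neg_log_dist t s) \<partial>(\<rho> \<Otimes>\<^sub>M \<rho>)) < \<infinity>"
    by (rule positive_part_finite_of_ext_integral[OF L])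
  have D: "Measurable.pred (\<rho> \<Otimes>\<^sub>M \<rho>) (\<lambda>p. fst p = snd p)" by measurable
  have "(\<integral>\<^sup>+p. \<infinity> * indicator {p\<in>space (\<rho> \<Otimes>\<^sub>M \<rho>). fst p = snd p} p \<partial>(\<rho> \<Otimes>\<^sub>M \<rho>)) < \<infinity>"
    by (rule order.strict_trans1[OF nn_integral_mono A])
      (auto simp: neg_log_dist_def split: split_indicator)
  hence "emeasure (\<rho> \<Otimes>\<^sub>M \<rho>) {p\<in>space (\<rho> \<Otimes>\<^sub>M \<rho>). fst p = snd p} = 0"
    using D by (subst (asm) nn_integral_cmult_indicator)
      (auto simp: ennreal_top_mult pred_def split: if_splits)
  thus ae: "AE p in \<rho> \<Otimes>\<^sub>M \<rho>. fst p \<noteq> snd p"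
    using D by (intro AE_I[of _ _ "{p\<in>space (\<rho> \<Otimes>\<^sub>M \<rho>). fst p = snd p}"]) (auto simp: pred_def)
  have "(\<integral>\<^sup>+p. ennreal (log_kernel p) \<partial>(\<rho> \<Otimes>\<^sub>M \<rho>))
      = (\<integral>\<^sup>+p. e2ennreal (case p of (t, s) \<Rightarrow> neg_log_dist t s) \<partial>(\<rho> \<Otimes>\<^sub>M \<rho>))"
    using ae by (intro nn_integral_cong_AE) (auto elim!: eventually_mono simp: neg_log_dist_off_diagonal)
  thus "(\<integral>\<^sup>+p. ennreal (log_kernel p) \<partial>(\<rho> \<Otimes>\<^sub>M \<rho>)) < \<infinity>" using A by simp
qed

text \<open>
  If the minimal energy were infinite, every probability measure would be a minimizer, and
  uniqueness would identify the Dirac masses at \<open>0\<close> and \<open>1\<close>.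
\<close>

lemma free_gibbs_energy_finite:
  assumes "is_free_gibbs v \<nu>"
  shows "free_energy v \<nu> < \<infinity>"
proof (rule ccontr)
  assume "\<not> ?thesis"
  hence "free_energy v \<nu> = \<infinity>" by simp
  hence all: "\<And>\<rho>. borel_prob \<rho> \<Longrightarrow> \<rho> = \<nu>" using assms by (auto simp: is_free_gibbs_def)
  have "borel_prob (return borel x)" for x :: real
    by (simp add: borel_prob_def prob_space_return)
  hence "return borel (0::real) = return borel 1" using all by metis
  moreover have "emeasure (return borel (0::real)) {0} = 1" "emeasure (return borel (1::real)) {0} = 0"
    by simp_all
  ultimately show False by simp
qed

section \<open>Potentials of linear growth\<close>

lemma convex_tangent:
  fixes v :: "real \<Rightarrow> real"
  assumes "convex_on UNIV v" "\<And>x. v differentiable (at x)"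
  shows "v x \<ge> v p + deriv v p * (x - p)"
  using convex_on_imp_above_tangent[OF assms(1), of p x "deriv v p"] assms(2)[of p]
  by (auto simp: DERIV_deriv_iff_real_differentiable)

lemma convex_deriv_mono:
  fixes v :: "real \<Rightarrow> real"
  assumes "convex_on UNIV v" "\<And>x. v differentiable (at x)"
  shows "mono (deriv v)"
proof
  fix x y :: real assume "x \<le> y"
  have "0 \<le> (deriv v y - deriv v x) * (y - x)"
    using convex_tangent[OF assms, of x y] convex_tangent[OF assms, of y x]
    by (simp add: algebra_simps)
  with \<open>x \<le> y\<close> show "deriv v x \<le> deriv v y"
    by (cases "x = y") (auto simp: zero_le_mult_iff)
qed

text \<open>
  A convex function lies above a tangent of positive slope and above one of negative slope.
\<close>

lemma convex_linear_growth:
  fixes v :: "real \<Rightarrow> real"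
  assumes v: "convex_on UNIV v" "\<And>x. v differentiable (at x)"
    and "deriv v p > 0" "deriv v q < 0"
  obtains c d where "c > 0" "\<And>x. c * \<bar>x\<bar> - d \<le> v x"
proof
  let ?c = "min (deriv v p) (- deriv v q)"
  let ?d = "\<bar>v p - deriv v p * p\<bar> + \<bar>v q - deriv v q * q\<bar>"
  show "?c > 0" using assms by simp
  fix x
  show "?c * \<bar>x\<bar> - ?d \<le> v x"
  proof (cases "x \<ge> 0")
    case True
    hence "?c * \<bar>x\<bar> \<le> deriv v p * x" by (simp add: mult_right_mono)
    thus ?thesis using convex_tangent[OF v, of p x] by (simp add: algebra_simps)
  next
    case False
    hence "?c * \<bar>x\<bar> \<le> - deriv v q * \<bar>x\<bar>" by (intro mult_right_mono) auto
    also have "\<dots> = deriv v q * x" using False by simp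
    finally show ?thesis using convex_tangent[OF v, of q x] by (simp add: algebra_simps)
  qed
qed

text \<open>
  Repulsion at large distances is at most the sum of two one-variable terms, which a confining
  potential can absorb.
\<close>

lemma ln_abs_diff_le: "ln \<bar>t - s\<bar> \<le> ln (1 + \<bar>t\<bar>) + ln (1 + \<bar>s\<bar>)" if "t \<noteq> s" for t s :: real
proof -
  have "\<bar>t - s\<bar> \<le> (1 + \<bar>t\<bar>) * (1 + \<bar>s\<bar>)"
    using mult_nonneg_nonneg[of "\<bar>t\<bar>" "\<bar>s\<bar>"] abs_triangle_ineq4[of t s]
    unfolding distrib_left distrib_right by linarith
  hence "ln \<bar>t - s\<bar> \<le> ln ((1 + \<bar>t\<bar>) * (1 + \<bar>s\<bar>))" using that by (subst ln_le_cancel_iff) (auto intro!: mult_pos_pos)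
  also have "\<dots> = ln (1 + \<bar>t\<bar>) + ln (1 + \<bar>s\<bar>)" by (rule ln_mult_pos) auto
  finally show ?thesis .
qed

lemma free_gibbs_integrability:
  assumes g: "is_free_gibbs v \<nu>" and [measurable]: "v \<in> borel_measurable borel"
    and c: "c > 0" "\<And>x. c * \<bar>x\<bar> - d \<le> v x"
  shows "AE p in \<nu> \<Otimes>\<^sub>M \<nu>. fst p \<noteq> snd p" "integrable (\<nu> \<Otimes>\<^sub>M \<nu>) log_kernel" "integrable \<nu> v"
proof -
  have bp: "borel_prob \<nu>" using g by (simp add: is_free_gibbs_def)
  then interpret prob_space \<nu> by (simp add: borel_prob_def)
  have [measurable_cong]: "sets \<nu> = sets borel" using bp by (simp add: borel_prob_def)
  note parts = finite_free_energy_parts[OF bp free_gibbs_energy_finite[OF g]]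
  show ae: "AE p in \<nu> \<Otimes>\<^sub>M \<nu>. fst p \<noteq> snd p" by (rule parts)
  show v: "integrable \<nu> v"
  proof (rule integrable_of_positive_part[where g = "\<lambda>_. d"])
    have "- d \<le> v x" for x using c(1) c(2)[of x] by (smt (verit) mult_nonneg_nonneg abs_ge_zero)
    thus "AE x in \<nu>. - d \<le> v x" by simp
  qed (use parts in auto)
  have x: "integrable \<nu> (\<lambda>x. \<bar>x\<bar>)"
  proof (rule Bochner_Integration.integrable_bound)
    show "integrable \<nu> (\<lambda>x. (v x + d) / c)" using v by simp
    show "AE x in \<nu>. norm \<bar>x\<bar> \<le> norm ((v x + d) / c)"
    proof (rule AE_I2)
      fix x
      have "\<bar>x\<bar> \<le> (v x + d) / c" using c(1) c(2)[of x] by (simp add: field_simps)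
      thus "norm \<bar>x\<bar> \<le> norm ((v x + d) / c)"
        unfolding real_norm_def abs_abs by (rule order_trans) (rule abs_ge_self)
    qed
  qed simp
  note xx = pair_coordinate_integrals[OF prob_space_axioms x]
  show "integrable (\<nu> \<Otimes>\<^sub>M \<nu>) log_kernel"
  proof (rule integrable_of_positive_part[where g = "\<lambda>p. \<bar>fst p\<bar> + \<bar>snd p\<bar>"])
    show "integrable (\<nu> \<Otimes>\<^sub>M \<nu>) (\<lambda>p. \<bar>fst p\<bar> + \<bar>snd p\<bar>)" using xx by simp
    show "AE p in \<nu> \<Otimes>\<^sub>M \<nu>. - (\<bar>fst p\<bar> + \<bar>snd p\<bar>) \<le> log_kernel p"
      using ae
    proof eventually_elim
      case (elim p)
      thus ?case using ln_abs_diff_le[OF elim] ln_add_one_self_le_self[of "\<bar>fst p\<bar>"]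
         ln_add_one_self_le_self[of "\<bar>snd p\<bar>"]
        by (simp add: log_kernel_def)
    qed
  qed (use parts in auto)
qed

section \<open>Compactness of the support of a free Gibbs measure\<close>

text \<open>
  With \<open>K(t, s) = - log \<bar>t - s\<bar> + (v t + v s) / 2\<close> the energy is \<open>E = \<integral>\<integral> K\<close>, and \<open>K(t, s)\<close> tends to infinity
  as \<open>\<bar>t\<bar> + \<bar>s\<bar>\<close> does. Choose \<open>A = [-R, R]\<close> such that \<open>K \<ge> E + 1\<close> off \<open>A \<times> A\<close>, and let \<open>q = \<nu>(A)\<close>. Conditioning
  \<open>\<nu>\<close> on \<open>A\<close> cannot lower the energy, so \<open>q\<^sup>2 E \<le> \<integral>\<integral>\<^bsub>A \<times> A\<^esub> K\<close>; hence
  \<open>E \<ge> q\<^sup>2 E + (1 - q\<^sup>2) (E + 1)\<close>, which forces \<open>q = 1\<close>.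
\<close>

lemma free_gibbs_bounded_support:
  assumes g: "is_free_gibbs v \<nu>" and [measurable]: "v \<in> borel_measurable borel"
    and c: "c > 0" "\<And>x. c * \<bar>x\<bar> - d \<le> v x"
  obtains R where "AE x in \<nu>. \<bar>x\<bar> \<le> R"
proof -
  have bp: "borel_prob \<nu>" using g by (simp add: is_free_gibbs_def)
  then interpret prob_space \<nu> by (simp add: borel_prob_def)
  have [measurable_cong]: "sets \<nu> = sets borel" using bp by (simp add: borel_prob_def)
  have sp: "space \<nu> = UNIV" using sets_eq_imp_space_eq[of \<nu> borel] bp by (simp add: borel_prob_def)
  interpret P: pair_prob_space \<nu> \<nu> ..
  let ?P = "\<nu> \<Otimes>\<^sub>M \<nu>"
  note I = free_gibbs_integrability[OF g _ c, simplified]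
  note V = pair_coordinate_integrals[OF prob_space_axioms I(3)]
  define K where "K p = log_kernel p + (v (fst p) + v (snd p)) / 2" for p
  have Kint: "integrable ?P K" unfolding K_def using I V by simp
  define E where "E = (\<integral>p. K p \<partial>?P)"
  have E: "free_energy v \<nu> = ereal E"
    using free_energy_eq_integrals[OF I(2,1,3)] I V by (simp add: E_def K_def)
  define a where "a = c / 4"
  define m where "m = d / 2 + a - 1 - ln a"
  have a: "a > 0" using c by (simp add: a_def)
  \<comment> \<open>the tangent of \<open>ln\<close> at \<open>1 / a\<close>; the slope \<open>c / 4\<close> leaves half of the growth \<open>c / 2\<close> of \<open>v / 2\<close>\<close>
  have lnb: "ln (1 + \<bar>t\<bar>) \<le> a * (1 + \<bar>t\<bar>) - 1 - ln a" for t :: real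
    using ln_le_minus_one[of "a * (1 + \<bar>t\<bar>)"] a by (simp add: ln_mult_pos)
  have Klow: "AE p in ?P. a * (\<bar>fst p\<bar> + \<bar>snd p\<bar>) - 2 * m \<le> K p"
    using I(1)
  proof eventually_elim
    case (elim p)
    have "4 * a * \<bar>fst p\<bar> - d \<le> v (fst p)" "4 * a * \<bar>snd p\<bar> - d \<le> v (snd p)"
      using c(2) by (simp_all add: a_def)
    thus ?case using ln_abs_diff_le[OF elim] lnb[of "fst p"] lnb[of "snd p"]
      by (simp add: K_def log_kernel_def m_def algebra_simps)
  qed
  define R where "R = max 0 ((E + 1 + 2 * m) / a)"
  have R: "E + 1 \<le> a * R - 2 * m" "R \<ge> 0"
  proof -
    have "(E + 1 + 2 * m) / a \<le> R" by (simp add: R_def)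
    thus "E + 1 \<le> a * R - 2 * m" using a by (simp add: field_simps)
  qed (simp add: R_def)
  define A where "A = {-R..R}"
  have [measurable]: "A \<in> sets \<nu>" "A \<in> sets borel" by (simp_all add: A_def)
  define q where "q = measure \<nu> A"
  let ?J = "\<lambda>p. indicator (A \<times> A) p :: real"
  have q2: "measure ?P (A \<times> A) = q^2"
    by (simp add: measure_def emeasure_pair_measure_Times enn2real_mult q_def power2_eq_square)
  have Jint: "integrable ?P (\<lambda>p. ?J p * K p)" "integrable ?P (\<lambda>p. (1 - ?J p) * K p)"
  proof -
    have "integrable ?P (\<lambda>p. ?J p *\<^sub>R K p)" by (rule integrable_mult_indicator[OF _ Kint]) simp
    thus *: "integrable ?P (\<lambda>p. ?J p * K p)" by simp
    from Bochner_Integration.integrable_diff[OF Kint this]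
    show "integrable ?P (\<lambda>p. (1 - ?J p) * K p)" by (simp add: algebra_simps)
  qed
  define S where "S = (\<integral>p. ?J p * K p \<partial>?P)"
  have ES: "E = S + (\<integral>p. (1 - ?J p) * K p \<partial>?P)"
    unfolding E_def S_def using Jint by (subst Bochner_Integration.integral_add[symmetric]) (simp_all add: algebra_simps)
  have J1: "integrable ?P ?J" by (intro integrable_real_indicator) (auto simp: P.emeasure_finite less_top[symmetric])
  have "(1 - q^2) * (E + 1) = (\<integral>p. (1 - ?J p) * (E + 1) \<partial>?P)"
    using q2 J1 by (simp add: P.prob_space)
  also have "\<dots> \<le> (\<integral>p. (1 - ?J p) * K p \<partial>?P)"
  proof (rule integral_mono_AE)
    show "AE p in ?P. (1 - ?J p) * (E + 1) \<le> (1 - ?J p) * K p"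
      using Klow
    proof eventually_elim
      case (elim p)
      show ?case
      proof (cases "p \<in> A \<times> A")
        case False
        hence "R \<le> \<bar>fst p\<bar> + \<bar>snd p\<bar>" by (cases p) (auto simp: A_def)
        hence "a * R \<le> a * (\<bar>fst p\<bar> + \<bar>snd p\<bar>)" using a by simp
        thus ?thesis using elim R False by simp
      qed simp
    qed
  qed (use J1 Jint in auto)
  finally have out: "(1 - q^2) * (E + 1) \<le> E - S" using ES by simp
  have q01: "0 \<le> q" "q \<le> 1" by (simp_all add: q_def)
  have "q = 1"
  proof (cases "q = 0")
    case True
    hence "emeasure ?P (A \<times> A) = 0" using q2 by (simp add: P.emeasure_eq_measure)
    hence "AE p in ?P. p \<notin> A \<times> A"
      by (intro AE_I[of _ _ "A \<times> A"]) auto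
    hence "S = 0" unfolding S_def
      by (intro integral_eq_zero_AE) (auto elim!: eventually_mono simp: indicator_def)
    with out True show ?thesis by simp
  next
    case False
    with q01 have q: "q > 0" by simp
    let ?g = "\<lambda>x. indicator A x / q :: real"
    define \<rho> where "\<rho> = density \<nu> (\<lambda>x. ennreal (?g x))"
    have prob: "prob_space \<rho>"
    proof
      have "emeasure \<rho> (space \<rho>) = (\<integral>\<^sup>+x. ennreal (1/q) * indicator A x \<partial>\<nu>)"
        unfolding \<rho>_def by (subst emeasure_density) (auto intro!: nn_integral_cong split: split_indicator simp: sp)
      also have "\<dots> = ennreal (1/q) * ennreal q"
        by (simp add: nn_integral_cmult_indicator q_def emeasure_eq_measure)
      also have "\<dots> = 1" using q by (simp add: ennreal_mult[symmetric])
      finally show "emeasure \<rho> (space \<rho>) = 1" .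
    qed
    have bp': "borel_prob \<rho>" using prob bp by (simp add: borel_prob_def \<rho>_def)
    have sf: "sigma_finite_measure \<rho>" using prob by (simp add: prob_space_imp_sigma_finite)
    have pd: "\<rho> \<Otimes>\<^sub>M \<rho> = density ?P (\<lambda>p. ennreal (?J p / q^2))"
    proof -
      have "\<rho> \<Otimes>\<^sub>M \<rho> = density ?P (\<lambda>(x, y). ennreal (?g x) * ennreal (?g y))"
        unfolding \<rho>_def using sf
        by (intro pair_measure_density) (auto simp: \<rho>_def intro: sigma_finite_measure_axioms)
      also have "(\<lambda>(x, y). ennreal (?g x) * ennreal (?g y)) = (\<lambda>p. ennreal (?J p / q^2))"
        using q by (auto simp: fun_eq_iff ennreal_mult[symmetric] indicator_times power2_eq_square split: split_indicator)
      finally show ?thesis .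
    qed
    have ae': "AE p in \<rho> \<Otimes>\<^sub>M \<rho>. fst p \<noteq> snd p"
      unfolding pd by (subst AE_density) (use I(1) in \<open>auto elim: eventually_mono\<close>)
    have int': "integrable (\<rho> \<Otimes>\<^sub>M \<rho>) f \<and> integral\<^sup>L (\<rho> \<Otimes>\<^sub>M \<rho>) f = (\<integral>p. ?J p * f p \<partial>?P) / q^2"
      if f: "integrable ?P f" for f
    proof -
      have [measurable]: "f \<in> borel_measurable ?P" using f by simp
      have "integrable ?P (\<lambda>p. ?J p *\<^sub>R f p)" by (rule integrable_mult_indicator[OF _ f]) simp
      thus ?thesis unfolding pd by (subst integrable_density integral_density; simp)+
    qed
    have v': "integrable \<rho> v"
    proof -
      have "integrable \<nu> (\<lambda>p. indicator A p *\<^sub>R v p)" by (rule integrable_mult_indicator[OF _ I(3)]) simp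
      thus ?thesis unfolding \<rho>_def using q by (subst integrable_density) auto
    qed
    note V' = pair_coordinate_integrals[OF prob v']
    have "free_energy v \<rho> = ereal ((\<integral>p. log_kernel p \<partial>(\<rho> \<Otimes>\<^sub>M \<rho>)) + (\<integral>x. v x \<partial>\<rho>))"
      using int'[OF I(2)] ae' v' by (intro free_energy_eq_integrals) auto
    also have "(\<integral>p. log_kernel p \<partial>(\<rho> \<Otimes>\<^sub>M \<rho>)) + (\<integral>x. v x \<partial>\<rho>) = integral\<^sup>L (\<rho> \<Otimes>\<^sub>M \<rho>) K"
      unfolding K_def using V' int'[OF I(2)] by simp
    also have "\<dots> = S / q^2" using int'[OF Kint] by (simp add: S_def)
    finally have "E \<le> S / q^2" using g bp' E by (auto simp: is_free_gibbs_def)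
    hence "q^2 * E \<le> S" using q by (simp add: field_simps)
    with out have "q^2 \<ge> 1" by (simp add: algebra_simps)
    with q01 show ?thesis by (metis antisym one_le_power power2_eq_square mult_left_le order_trans)
  qed
  hence "AE x in \<nu>. x \<in> A" by (subst prob_eq_1[symmetric]) (simp_all add: q_def)
  hence "AE x in \<nu>. \<bar>x\<bar> \<le> R" by eventually_elim (auto simp: A_def)
  thus thesis by (rule that)
qed

section \<open>One-sided first variation of the energy\<close>

lemma AE_pair_coordinates:
  assumes "prob_space M" and Q: "AE x in M. Q x"
  shows "AE p in M \<Otimes>\<^sub>M M. Q (fst p) \<and> Q (snd p)"
proof -
  interpret prob_space M by fact
  obtain N where N: "{x\<in>space M. \<not> Q x} \<subseteq> N" "emeasure M N = 0" "N \<in> sets M"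
    using Q by (rule AE_E)
  show ?thesis
  proof (rule AE_I)
    show "{p\<in>space (M \<Otimes>\<^sub>M M). \<not> (Q (fst p) \<and> Q (snd p))} \<subseteq> N \<times> space M \<union> space M \<times> N"
      using N(1) by (auto simp: space_pair_measure)
    show "emeasure (M \<Otimes>\<^sub>M M) (N \<times> space M \<union> space M \<times> N) = 0"
      using N by (intro emeasure_Un_null_set[THEN trans] null_setsI) (simp_all add: emeasure_pair_measure_Times)
    show "N \<times> space M \<union> space M \<times> N \<in> sets (M \<Otimes>\<^sub>M M)" using N(3) by simp
  qed
qed

lemma difference_quotient_sequence:
  fixes f :: "real \<Rightarrow> real"
  assumes D: "(f has_real_derivative D) (at 0)" and t: "t \<longlonglongrightarrow> 0" "\<And>n. t n \<noteq> 0"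
  shows "(\<lambda>n. (f (t n) - f 0) / t n) \<longlonglongrightarrow> D"
proof -
  have "filterlim t (at 0) sequentially"
    using t by (auto simp: filterlim_at)
  from filterlim_compose[OF D[unfolded DERIV_def] this] show ?thesis by simp
qed

lemma ln_one_plus_lower:
  fixes z :: real assumes "- 1 / 2 \<le> z"
  shows "min 0 (2 * z) \<le> ln (1 + z)"
proof (cases "z \<ge> 0")
  case False
  have "- (-z) - 2 * (-z)^2 \<le> ln (1 - (-z))"
    using assms False by (intro ln_one_minus_pos_lower_bound) auto
  moreover have "(-z) * (1 + 2 * z) \<ge> 0" using assms False by (intro mult_nonneg_nonneg) auto
  ultimately show ?thesis using False by (simp add: power2_eq_square algebra_simps)
qed simp

definition one_sided_lipschitz :: "real \<Rightarrow> ('a \<Rightarrow> real) \<Rightarrow> ('a \<Rightarrow> real) \<Rightarrow> bool" where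
  "one_sided_lipschitz C Z \<psi> \<longleftrightarrow> (\<forall>x s. Z s < Z x \<longrightarrow> - C * (Z x - Z s) \<le> \<psi> x - \<psi> s)"

definition pair_quotient :: "('a \<Rightarrow> real) \<Rightarrow> ('a \<Rightarrow> real) \<Rightarrow> 'a \<times> 'a \<Rightarrow> real" where
  "pair_quotient \<psi> Z p = (\<psi> (fst p) - \<psi> (snd p)) / (Z (fst p) - Z (snd p))"

lemma measurable_pair_quotient [measurable]:
  assumes [measurable]: "\<psi> \<in> borel_measurable M" "Z \<in> borel_measurable M"
  shows "pair_quotient \<psi> Z \<in> borel_measurable (M \<Otimes>\<^sub>M M)"
  unfolding pair_quotient_def by measurable

lemma pair_quotient_lower:
  assumes "one_sided_lipschitz C Z \<psi>" "C \<ge> 0"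
  shows "- C \<le> pair_quotient \<psi> Z p"
proof -
  obtain x s where p: "p = (x, s)" by force
  consider "Z s < Z x" | "Z x < Z s" | "Z x = Z s" by linarith
  thus ?thesis
  proof cases
    case 1
    with assms show ?thesis by (auto simp: p pair_quotient_def one_sided_lipschitz_def pos_le_divide_eq)
  next
    case 2
    hence "- C * (Z s - Z x) \<le> \<psi> s - \<psi> x" using assms by (auto simp: one_sided_lipschitz_def)
    thus ?thesis using 2 by (simp add: p pair_quotient_def neg_le_divide_eq algebra_simps)
  qed (use assms in \<open>simp add: p pair_quotient_def\<close>)
qed

text \<open>
  Half of the Schwinger--Dyson equation \<open>\<integral> v'(y) \<chi>(y) d\<nu>(y) = \<integral>\<integral> (\<chi>(y) - \<chi>(t)) / (y - t) d\<nu>(t) d\<nu>(y)\<close> of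
  a free Gibbs measure, written for the image \<open>\<nu>\<close> of \<open>\<eta>\<close> under \<open>Z\<close> with \<open>\<psi> = \<chi> \<circ> Z\<close> and \<open>f = v' \<circ> Z\<close>. Equality
  for smooth \<open>\<chi>\<close> would be of little use: the test functions below are Lipschitz in \<open>x\<close>, and
  become functions of \<open>y = Z x\<close> whose slopes are controlled from one side only, as no lower bound
  on the slopes of \<open>Z\<close> is known beforehand. A lower bound on slopes is exactly what the inequality requires.
\<close>

definition first_variation_bound :: "'a measure \<Rightarrow> ('a \<Rightarrow> real) \<Rightarrow> ('a \<Rightarrow> real) \<Rightarrow> bool" where
  "first_variation_bound \<eta> Z f \<longleftrightarrow>
     (\<forall>\<psi> B C. \<psi> \<in> borel_measurable \<eta> \<and> (\<forall>x. \<bar>\<psi> x\<bar> \<le> B) \<and> one_sided_lipschitz C Z \<psi> \<longrightarrow>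
        integrable (\<eta> \<Otimes>\<^sub>M \<eta>) (pair_quotient \<psi> Z) \<and>
        (\<integral>p. pair_quotient \<psi> Z p \<partial>(\<eta> \<Otimes>\<^sub>M \<eta>)) \<le> (\<integral>x. f x * \<psi> x \<partial>\<eta>))"

text \<open>
  The minimizer \<open>\<nu>\<close> is compared with the law of \<open>Z + t \<psi>\<close> for small \<open>t > 0\<close>. Writing \<open>q\<close> for the
  difference quotient of \<open>\<psi>\<close> with respect to \<open>Z\<close>, distances are multiplied by \<open>1 + t q\<close>, so minimality reads
  \<open>\<integral>\<integral> log (1 + t q) / t \<le> \<integral> (v (Z + t \<psi>) - v Z) / t\<close>. As \<open>q \<ge> - C\<close>, the left integrands are bounded
  below by \<open>- 2 C\<close> for \<open>t \<le> 1 / (2 C)\<close>, and Fatou's lemma lets \<open>t\<close> tend to \<open>0\<close>; integrability of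
  \<open>q\<close> is part of the conclusion.
\<close>

lemma free_gibbs_first_variation:
  assumes g: "is_free_gibbs v \<nu>"
    and off: "AE p in \<nu> \<Otimes>\<^sub>M \<nu>. fst p \<noteq> snd p" and lk: "integrable (\<nu> \<Otimes>\<^sub>M \<nu>) log_kernel"
    and R: "AE y in \<nu>. \<bar>y\<bar> \<le> R"
    and \<eta>: "borel_prob \<eta>" and [measurable]: "Z \<in> borel_measurable borel" and \<nu>: "\<nu> = distr \<eta> borel Z"
    and v: "\<And>x. v differentiable (at x)" "continuous_on UNIV (deriv v)"
  shows "first_variation_bound \<eta> Z (\<lambda>x. deriv v (Z x))"
  unfolding first_variation_bound_def
proof (intro allI impI, elim conjE)
  interpret prob_space \<eta> using \<eta> by (simp add: borel_prob_def)
  have [measurable_cong]: "sets \<eta> = sets borel" using \<eta> by (simp add: borel_prob_def)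
  interpret P: pair_prob_space \<eta> \<eta> ..
  let ?P = "\<eta> \<Otimes>\<^sub>M \<eta>"
  fix \<psi> B C0
  assume [measurable]: "\<psi> \<in> borel_measurable \<eta>" and B: "\<forall>x. \<bar>\<psi> x\<bar> \<le> B"
    and C0: "one_sided_lipschitz C0 Z \<psi>"
  have [measurable]: "\<psi> \<in> borel_measurable borel"
    using measurable_cong_sets[of \<eta> borel borel borel] \<eta> \<open>\<psi> \<in> borel_measurable \<eta>\<close> by (simp add: borel_prob_def)
  have B0: "B \<ge> 0" using B abs_ge_zero order_trans by blast
  \<comment> \<open>a positive constant, so that \<open>1 / (2 * C)\<close> is a genuine range for \<open>t\<close>, and is at most \<open>1\<close>\<close>
  define C where "C = max 1 C0"
  have C: "C \<ge> 1" by (simp add: C_def)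
  have osl: "one_sided_lipschitz C Z \<psi>"
    unfolding one_sided_lipschitz_def
  proof (intro allI impI)
    fix x s assume "Z s < Z x"
    moreover from this have "C0 * (Z x - Z s) \<le> C * (Z x - Z s)" by (intro mult_right_mono) (auto simp: C_def)
    ultimately show "- C * (Z x - Z s) \<le> \<psi> x - \<psi> s" using C0 unfolding one_sided_lipschitz_def by (smt (verit) mult_minus_left)
  qed
  let ?q = "pair_quotient \<psi> Z"
  have qC: "- C \<le> ?q p" for p using pair_quotient_lower[OF osl, of p] C by simp
  have pr: "distr \<eta> borel f \<Otimes>\<^sub>M distr \<eta> borel f = distr ?P (borel \<Otimes>\<^sub>M borel) (\<lambda>p. (f (fst p), f (snd p)))"
    if [measurable]: "f \<in> borel_measurable borel" for f :: "real \<Rightarrow> real"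
  proof -
    interpret D: prob_space "distr \<eta> borel f" by (rule prob_space_distr) simp
    show ?thesis
      by (subst pair_measure_distr) (auto simp: case_prod_beta' intro: D.sigma_finite_measure_axioms)
  qed
  have off: "AE p in ?P. Z (fst p) \<noteq> Z (snd p)"
    using off unfolding \<nu> pr[OF \<open>Z \<in> borel_measurable borel\<close>] by (subst (asm) AE_distr_iff) auto
  have R: "AE x in \<eta>. \<bar>Z x\<bar> \<le> R" using R unfolding \<nu> by (subst (asm) AE_distr_iff) auto
  have vc: "continuous_on A v" for A
    using v(1) by (intro continuous_at_imp_continuous_on ballI differentiable_imp_continuous_within) auto
  have [measurable]: "v \<in> borel_measurable borel" "deriv v \<in> borel_measurable borel"
    using vc v(2) by (auto intro: borel_measurable_continuous_onI)
  obtain b where b: "\<And>y. \<bar>y\<bar> \<le> R + B \<Longrightarrow> \<bar>v y\<bar> \<le> b"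
    "\<And>y. \<bar>y\<bar> \<le> R + B \<Longrightarrow> \<bar>deriv v y\<bar> \<le> b"
  proof -
    have "bounded (v ` {-(R + B)..R + B})" "bounded (deriv v ` {-(R + B)..R + B})"
      using vc continuous_on_subset[OF v(2)] by (auto intro!: compact_imp_bounded compact_continuous_image)
    then obtain b1 b2 where "\<forall>y\<in>{-(R + B)..R + B}. \<bar>v y\<bar> \<le> b1" "\<forall>y\<in>{-(R + B)..R + B}. \<bar>deriv v y\<bar> \<le> b2"
      unfolding bounded_iff by auto
    hence "\<bar>v y\<bar> \<le> max b1 b2" "\<bar>deriv v y\<bar> \<le> max b1 b2" if "\<bar>y\<bar> \<le> R + B" for y
      using that by (auto simp: abs_le_iff le_max_iff_disj)
    thus thesis by (rule that)
  qed
  define W where "W t x = Z x + t * \<psi> x" for t x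
  have [measurable]: "W t \<in> borel_measurable borel" for t unfolding W_def by measurable
  have Wb: "\<bar>W t x\<bar> \<le> R + B" if "0 \<le> t" "t \<le> 1" "\<bar>Z x\<bar> \<le> R" for t x
  proof -
    have "\<bar>t * \<psi> x\<bar> \<le> 1 * B" unfolding abs_mult using that B by (intro mult_mono) auto
    thus ?thesis using that by (simp add: W_def)
  qed
  have lkZ: "integrable ?P (\<lambda>p. log_kernel (Z (fst p), Z (snd p)))"
    using lk unfolding \<nu> pr[OF \<open>Z \<in> borel_measurable borel\<close>] by (subst (asm) integrable_distr_eq) auto
  have intW: "integrable \<eta> (\<lambda>x. v (W t x))" if "0 \<le> t" "t \<le> 1" for t
  proof (rule integrable_const_bound[where B = b])
    show "AE x in \<eta>. norm (v (W t x)) \<le> b"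
      using R by eventually_elim (use b(1) Wb[OF that] in auto)
  qed measurable
  have step: "integrable ?P (\<lambda>p. ln (1 + t * ?q p)) \<and>
      (\<integral>p. ln (1 + t * ?q p) \<partial>?P) \<le> (\<integral>x. v (W t x) - v (Z x) \<partial>\<eta>)"
    if t: "0 < t" "t \<le> 1 / (2 * C)" for t
  proof -
    have t1: "t \<le> 1" using t C by (smt (verit) divide_le_eq_1_pos)
    have half: "1 / 2 \<le> 1 + t * ?q p" for p
    proof -
      have "t * (- C) \<le> t * ?q p" using t qC by (intro mult_left_mono) auto
      moreover have "t * C \<le> 1 / 2" using t C by (simp add: field_simps)
      ultimately show ?thesis by simp
    qed
    have ratio: "W t (fst p) - W t (snd p) = (Z (fst p) - Z (snd p)) * (1 + t * ?q p)"
      if "Z (fst p) \<noteq> Z (snd p)" for p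
      using that by (simp add: W_def pair_quotient_def field_simps)
    have offW: "AE p in ?P. W t (fst p) \<noteq> W t (snd p)"
      using off
    proof eventually_elim
      case (elim p)
      thus ?case using ratio[OF elim] half[of p] by auto
    qed
    have lkW_eq: "AE p in ?P. log_kernel (W t (fst p), W t (snd p))
        = log_kernel (Z (fst p), Z (snd p)) - ln (1 + t * ?q p)"
      using off
    proof eventually_elim
      case (elim p)
      have "ln \<bar>W t (fst p) - W t (snd p)\<bar> = ln (\<bar>Z (fst p) - Z (snd p)\<bar> * (1 + t * ?q p))"
        using half[of p] by (simp add: ratio[OF elim] abs_mult)
      also have "\<dots> = ln \<bar>Z (fst p) - Z (snd p)\<bar> + ln (1 + t * ?q p)"
        using half[of p] elim by (intro ln_mult_pos) auto
      finally show ?case by (simp add: log_kernel_def)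
    qed
    have lkW: "integrable ?P (\<lambda>p. log_kernel (W t (fst p), W t (snd p)))"
    proof (rule Bochner_Integration.integrable_bound)
      show "integrable ?P (\<lambda>p. \<bar>log_kernel (Z (fst p), Z (snd p))\<bar> + (ln 2 + 2 * \<bar>R + B\<bar>))"
        using lkZ by auto
      show "AE p in ?P. norm (log_kernel (W t (fst p), W t (snd p)))
          \<le> norm (\<bar>log_kernel (Z (fst p), Z (snd p))\<bar> + (ln 2 + 2 * \<bar>R + B\<bar>))"
        using lkW_eq offW AE_pair_coordinates[OF prob_space_axioms R]
      proof eventually_elim
        case (elim p)
        have "ln (1 / 2) \<le> ln (1 + t * ?q p)" using half[of p] by (subst ln_le_cancel_iff) auto
        hence 1: "log_kernel (W t (fst p), W t (snd p)) \<le> log_kernel (Z (fst p), Z (snd p)) + ln 2"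
          using elim by (simp add: ln_div)
        have "ln \<bar>W t (fst p) - W t (snd p)\<bar> \<le> \<bar>W t (fst p) - W t (snd p)\<bar>"
          using elim ln_le_minus_one[of "\<bar>W t (fst p) - W t (snd p)\<bar>"] by simp
        also have "\<dots> \<le> 2 * (R + B)"
          using Wb[of t "fst p"] Wb[of t "snd p"] t t1 elim by simp
        finally have 2: "- log_kernel (W t (fst p), W t (snd p)) \<le> 2 * (R + B)" by (simp add: log_kernel_def)
        have 3: "0 \<le> ln (2::real)" by simp
        show ?case unfolding real_norm_def using 1 2 3 by (smt (verit))
      qed
    qed measurable
    have intln: "integrable ?P (\<lambda>p. ln (1 + t * ?q p))"
      and lneq: "(\<integral>p. ln (1 + t * ?q p) \<partial>?P) = (\<integral>p. log_kernel (Z (fst p), Z (snd p)) \<partial>?P)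
         - (\<integral>p. log_kernel (W t (fst p), W t (snd p)) \<partial>?P)"
    proof -
      have *: "AE p in ?P. ln (1 + t * ?q p) = log_kernel (Z (fst p), Z (snd p)) - log_kernel (W t (fst p), W t (snd p))"
        using lkW_eq by eventually_elim simp
      show "integrable ?P (\<lambda>p. ln (1 + t * ?q p))"
        by (subst integrable_cong_AE[OF _ _ *]) (use lkW lkZ in auto)
      show "(\<integral>p. ln (1 + t * ?q p) \<partial>?P) = (\<integral>p. log_kernel (Z (fst p), Z (snd p)) \<partial>?P)
         - (\<integral>p. log_kernel (W t (fst p), W t (snd p)) \<partial>?P)"
        by (subst integral_cong_AE[OF _ _ *]) (use lkW lkZ in auto)
    qed
    have energy: "free_energy v (distr \<eta> borel (W s)) =
        ereal ((\<integral>p. log_kernel (W s (fst p), W s (snd p)) \<partial>?P) + (\<integral>x. v (W s x) \<partial>\<eta>))"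
      if s: "0 \<le> s" "s \<le> 1" and 1: "integrable ?P (\<lambda>p. log_kernel (W s (fst p), W s (snd p)))"
        and 2: "AE p in ?P. W s (fst p) \<noteq> W s (snd p)" for s
    proof -
      note pr = pr[OF \<open>W s \<in> borel_measurable borel\<close>]
      have "free_energy v (distr \<eta> borel (W s)) =
          ereal ((\<integral>p. log_kernel p \<partial>(distr \<eta> borel (W s) \<Otimes>\<^sub>M distr \<eta> borel (W s))) + (\<integral>x. v x \<partial>distr \<eta> borel (W s)))"
      proof (rule free_energy_eq_integrals)
        show "integrable (distr \<eta> borel (W s) \<Otimes>\<^sub>M distr \<eta> borel (W s)) log_kernel"
          unfolding pr using 1 by (subst integrable_distr_eq) auto
        show "AE p in distr \<eta> borel (W s) \<Otimes>\<^sub>M distr \<eta> borel (W s). fst p \<noteq> snd p"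
          unfolding pr using 2 by (subst AE_distr_iff) auto
        show "integrable (distr \<eta> borel (W s)) v"
          using intW[OF s] by (subst integrable_distr_eq) auto
      qed
      thus ?thesis unfolding pr by (simp add: integral_distr)
    qed
    have W0: "W 0 = Z" by (simp add: W_def fun_eq_iff)
    have "borel_prob (distr \<eta> borel (W t))"
      by (simp add: borel_prob_def prob_space_distr)
    hence "free_energy v (distr \<eta> borel (W 0)) \<le> free_energy v (distr \<eta> borel (W t))"
      using g by (simp add: is_free_gibbs_def \<nu> W0)
    hence "(\<integral>p. log_kernel (Z (fst p), Z (snd p)) \<partial>?P) + (\<integral>x. v (Z x) \<partial>\<eta>)
        \<le> (\<integral>p. log_kernel (W t (fst p), W t (snd p)) \<partial>?P) + (\<integral>x. v (W t x) \<partial>\<eta>)"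
      using energy[of 0] energy[of t] lkZ off offW lkW t t1 by (simp add: W0)
    moreover have "(\<integral>x. v (W t x) - v (Z x) \<partial>\<eta>) = (\<integral>x. v (W t x) \<partial>\<eta>) - (\<integral>x. v (Z x) \<partial>\<eta>)"
      using intW[of t] intW[of 0] t t1 by (intro Bochner_Integration.integral_diff) (simp_all add: W0)
    ultimately show ?thesis using intln lneq by simp
  qed
  define t where "t n = 1 / (2 * C) / real (Suc n)" for n
  have tpos: "0 < t n" for n using C by (simp add: t_def)
  have tle: "t n \<le> 1 / (2 * C)" for n
  proof -
    have "1 / (2 * C) / real (Suc n) \<le> 1 / (2 * C) / 1" using C by (intro divide_left_mono) auto
    thus ?thesis by (simp add: t_def)
  qed
  have t0: "t \<longlonglongrightarrow> 0" unfolding t_def by (rule lim_const_over_n[THEN LIMSEQ_Suc])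
  have tn0: "t n \<noteq> 0" for n using tpos[of n] by simp
  have tle1: "t n \<le> 1" for n using tle[of n] C by (smt (verit) divide_le_eq_1_pos)
  define r where "r n = (\<integral>x. (v (W (t n) x) - v (Z x)) / t n \<partial>\<eta>)" for n
  define rr where "rr = (\<integral>x. deriv v (Z x) * \<psi> x \<partial>\<eta>)"
  have rlim: "r \<longlonglongrightarrow> rr"
    unfolding r_def rr_def
  proof (rule integral_dominated_convergence[where w = "\<lambda>_. b * B"])
    show "AE x in \<eta>. (\<lambda>n. (v (W (t n) x) - v (Z x)) / t n) \<longlonglongrightarrow> deriv v (Z x) * \<psi> x"
    proof (rule AE_I2)
      fix x
      have "((\<lambda>h. v (W h x)) has_real_derivative deriv v (Z x) * \<psi> x) (at 0)"
        unfolding W_def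
        by (rule DERIV_chain2[where f = v])
          (use v(1) in \<open>auto intro!: derivative_eq_intros simp: DERIV_deriv_iff_real_differentiable\<close>)
      from difference_quotient_sequence[OF this t0 tn0]
      show "(\<lambda>n. (v (W (t n) x) - v (Z x)) / t n) \<longlonglongrightarrow> deriv v (Z x) * \<psi> x" by (simp add: W_def)
    qed
    show "AE x in \<eta>. norm ((v (W (t n) x) - v (Z x)) / t n) \<le> b * B" for n
      using R
    proof eventually_elim
      case (elim x)
      have "norm (v (W (t n) x) - v (Z x)) \<le> b * norm (W (t n) x - Z x)"
      proof (rule field_differentiable_bound)
        show "convex {-(R + B)..R + B}" by simp
        show "(v has_field_derivative deriv v z) (at z within {-(R + B)..R + B})" for z
          using v(1)[of z] by (auto simp: DERIV_deriv_iff_real_differentiable intro: has_field_derivative_at_within)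
        show "norm (deriv v z) \<le> b" if "z \<in> {-(R + B)..R + B}" for z
          using b(2)[of z] that by (auto simp: abs_le_iff)
        show "W (t n) x \<in> {-(R + B)..R + B}" using Wb[of "t n" x] tpos[of n] tle1[of n] elim by (auto simp: abs_le_iff)
        show "Z x \<in> {-(R + B)..R + B}" using elim B0 by (auto simp: abs_le_iff)
      qed
      also have "norm (W (t n) x - Z x) = t n * \<bar>\<psi> x\<bar>" using tpos[of n] by (simp add: W_def abs_mult)
      also have "b * (t n * \<bar>\<psi> x\<bar>) \<le> b * (t n * B)"
      proof -
        have "b \<ge> 0" using b(1)[of "Z x"] elim B0 by auto
        thus ?thesis using B tpos[of n] by (intro mult_left_mono) auto
      qed
      finally show ?case using tpos[of n] by (simp add: field_simps)
    qed
  qed auto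
  \<comment> \<open>shifted by \<open>2 * C\<close> to be nonnegative, as Fatou requires\<close>
  let ?h = "\<lambda>n p. ln (1 + t n * ?q p) / t n + 2 * C"
  have hpos: "0 \<le> ?h n p" for n p
  proof -
    have tC2: "t n * C \<le> 1 / 2" using tle[of n] C by (simp add: field_simps)
    have tq: "- (t n * C) \<le> t n * ?q p" using mult_left_mono[OF qC[of p], of "t n"] tpos[of n] by simp
    have m1: "min 0 (2 * (t n * ?q p)) \<le> ln (1 + t n * ?q p)" using tq tC2 by (intro ln_one_plus_lower) simp
    have m2: "- (2 * (t n * C)) \<le> min 0 (2 * (t n * ?q p))"
    proof -
      have "0 \<le> t n * C" using tpos[of n] C by (intro mult_nonneg_nonneg) simp_all
      thus ?thesis unfolding min.bounded_iff using tq by (intro conjI; linarith)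
    qed
    have "- (2 * C) * t n \<le> ln (1 + t n * ?q p)" using order_trans[OF m2 m1] by (simp add: mult_ac)
    thus ?thesis using tpos[of n] by (simp add: field_simps)
  qed
  have "(\<integral>\<^sup>+p. ennreal (?q p + 2 * C) \<partial>?P) = (\<integral>\<^sup>+p. liminf (\<lambda>n. ennreal (?h n p)) \<partial>?P)"
  proof (rule nn_integral_cong)
    fix p
    have "((\<lambda>h. ln (1 + h * ?q p)) has_real_derivative ?q p) (at 0)"
      by (auto intro!: derivative_eq_intros)
    from difference_quotient_sequence[OF this t0 tn0]
    have "(\<lambda>n. ennreal (?h n p)) \<longlonglongrightarrow> ennreal (?q p + 2 * C)"
      by (intro tendsto_intros) simp_all
    thus "ennreal (?q p + 2 * C) = liminf (\<lambda>n. ennreal (?h n p))"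
      by (simp add: lim_imp_Liminf)
  qed
  also have "\<dots> \<le> liminf (\<lambda>n. \<integral>\<^sup>+p. ennreal (?h n p) \<partial>?P)"
    by (intro nn_integral_liminf) measurable
  also have "\<dots> \<le> liminf (\<lambda>n. ennreal (r n + 2 * C))"
  proof (intro Liminf_mono always_eventually allI)
    fix n
    note s = step[OF tpos tle, of n]
    have i: "integrable ?P (?h n)" using s by auto
    have "(\<integral>\<^sup>+p. ennreal (?h n p) \<partial>?P) = ennreal (integral\<^sup>L ?P (?h n))"
      using i hpos by (intro nn_integral_eq_integral) auto
    also have "integral\<^sup>L ?P (?h n) = (\<integral>p. ln (1 + t n * ?q p) \<partial>?P) / t n + 2 * C"
      using s by (simp add: P.prob_space)
    also have "(\<integral>p. ln (1 + t n * ?q p) \<partial>?P) / t n \<le> r n"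
      using s tpos[of n] by (simp add: r_def divide_right_mono)
    finally show "(\<integral>\<^sup>+p. ennreal (?h n p) \<partial>?P) \<le> ennreal (r n + 2 * C)"
      by (simp add: ennreal_leI)
  qed
  also have "\<dots> = ennreal (rr + 2 * C)"
    by (intro lim_imp_Liminf tendsto_intros tendsto_ennrealI rlim) simp
  finally have F: "(\<integral>\<^sup>+p. ennreal (?q p + 2 * C) \<partial>?P) \<le> ennreal (rr + 2 * C)" .
  have qpos: "0 \<le> ?q p + 2 * C" for p using qC[of p] C by simp
  have iq: "integrable ?P (\<lambda>p. ?q p + 2 * C)"
    using F qpos by (intro integrableI_nonneg) (auto intro: le_less_trans)
  have iq': "integrable ?P ?q" using Bochner_Integration.integrable_diff[OF iq, of "\<lambda>_. 2 * C"] by simp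
  have "ennreal (integral\<^sup>L ?P ?q + 2 * C) \<le> ennreal (rr + 2 * C)"
    using F qpos iq iq' by (simp add: nn_integral_eq_integral P.prob_space)
  moreover have "- C \<le> integral\<^sup>L ?P ?q"
    using integral_mono[of ?P "\<lambda>_. - C" ?q] iq' qC by (simp add: P.prob_space)
  ultimately have "integral\<^sup>L ?P ?q \<le> rr"
    using C by (cases "rr + 2 * C \<ge> 0") (auto simp: ennreal_le_iff ennreal_neg)
  with iq' show "integrable ?P ?q \<and> integral\<^sup>L ?P ?q \<le> (\<integral>x. deriv v (Z x) * \<psi> x \<partial>\<eta>)"
    by (simp add: rr_def)
qed

section \<open>The three-point inequality\<close>

definition clip :: "real \<Rightarrow> real" where "clip r = min 1 (max 0 r)"

text \<open>
  Only pairs on which the increment of \<open>Y\<close> exceeds \<open>M\<close> times that of \<open>X\<close> have a positive excess. Taking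
  the positive parts of the increments separately gives one formula for both orders of the pair.
\<close>

definition excess :: "real \<Rightarrow> ('a \<Rightarrow> real) \<Rightarrow> ('a \<Rightarrow> real) \<Rightarrow> 'a \<Rightarrow> 'a \<Rightarrow> real" where
  "excess M X Y x y = clip (max 0 (Y x - Y y) - M * max 0 (X x - X y))"

definition signed_excess :: "real \<Rightarrow> ('a \<Rightarrow> real) \<Rightarrow> ('a \<Rightarrow> real) \<Rightarrow> 'a \<Rightarrow> 'a \<Rightarrow> real" where
  "signed_excess M X Y x y = excess M X Y x y - excess M X Y y x"

lemma clip_mono: "r \<le> r' \<Longrightarrow> clip r \<le> clip r'"
  and clip_nonneg: "0 \<le> clip r" and clip_le_1: "clip r \<le> 1"
  and clip_nonpos: "r \<le> 0 \<Longrightarrow> clip r = 0"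
  and clip_pos_iff: "0 < clip r \<longleftrightarrow> 0 < r"
  and clip_diff_le: "r \<le> r' + c \<Longrightarrow> 0 \<le> c \<Longrightarrow> clip r \<le> clip r' + c"
  by (auto simp: clip_def min_def max_def)

lemma measurable_signed_excess [measurable]:
  assumes [measurable]: "X \<in> borel_measurable M" "Y \<in> borel_measurable M"
    "f \<in> measurable N M" "g \<in> measurable N M"
  shows "(\<lambda>z. signed_excess m X Y (f z) (g z)) \<in> borel_measurable N"
  unfolding signed_excess_def excess_def clip_def by measurable

lemma signed_excess_swap: "signed_excess M X Y y x = - signed_excess M X Y x y"
  by (simp add: signed_excess_def)

lemma abs_signed_excess_le_1: "\<bar>signed_excess M X Y x y\<bar> \<le> 1"
  unfolding signed_excess_def excess_def
  using clip_nonneg clip_le_1 by (smt (verit))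

text \<open>
  Moving \<open>x\<close> to the right, the increment of \<open>X\<close> can only lower the excess and that of \<open>Y\<close> can only raise it.
  So the slope with respect to \<open>X\<close> is bounded below and the slope with respect to \<open>Y\<close> is bounded
  above: the average of the signed excess may be inserted in the first variation for \<open>X\<close>, and its negative in
  the one for \<open>Y\<close>.
\<close>

lemma signed_excess_increment:
  assumes M: "0 \<le> M" and X: "X s \<le> X x" and Y: "Y s \<le> Y x"
  shows "- (2 * M) * (X x - X s) \<le> signed_excess M X Y x y - signed_excess M X Y s y"
    "signed_excess M X Y x y - signed_excess M X Y s y \<le> 2 * (Y x - Y s)"
proof -
  have mx: "M * max 0 (X x - X y) \<le> M * max 0 (X s - X y) + M * (X x - X s)"
    "M * max 0 (X y - X s) \<le> M * max 0 (X y - X x) + M * (X x - X s)"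
    "M * max 0 (X s - X y) \<le> M * max 0 (X x - X y)"
    "M * max 0 (X y - X x) \<le> M * max 0 (X y - X s)"
    unfolding distrib_left[symmetric] using M X by (intro mult_left_mono; simp)+
  have MX: "0 \<le> M * (X x - X s)" using M X by simp
  have "excess M X Y s y \<le> excess M X Y x y + M * (X x - X s)"
    "excess M X Y y x \<le> excess M X Y y s + M * (X x - X s)"
    unfolding excess_def using mx MX Y by (intro clip_diff_le; simp add: max_def split: if_splits)+
  thus "- (2 * M) * (X x - X s) \<le> signed_excess M X Y x y - signed_excess M X Y s y"
    by (simp add: signed_excess_def algebra_simps)
  have "excess M X Y x y \<le> excess M X Y s y + (Y x - Y s)"
    "excess M X Y y s \<le> excess M X Y y x + (Y x - Y s)"
    unfolding excess_def using mx Y by (intro clip_diff_le; simp add: max_def split: if_splits)+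
  thus "signed_excess M X Y x y - signed_excess M X Y s y \<le> 2 * (Y x - Y s)"
    by (simp add: signed_excess_def algebra_simps)
qed

definition kernel_gap :: "real \<Rightarrow> ('a \<Rightarrow> real) \<Rightarrow> ('a \<Rightarrow> real) \<Rightarrow> 'a \<Rightarrow> 'a \<Rightarrow> real" where
  "kernel_gap M X Y x s = 1 / (Y x - Y s) - 1 / (M * (X x - X s))"

text \<open>
  Integrating over \<open>y\<close> gives \<open>(\<psi> x - \<psi> s) * kernel_gap M X Y x s\<close> for the averaged signed excess \<open>\<psi>\<close>, which
  is what remains when \<open>1 / M\<close> times the first variation for \<open>X\<close> is subtracted from the one for \<open>Y\<close>.
\<close>

definition interaction :: "real \<Rightarrow> ('a \<Rightarrow> real) \<Rightarrow> ('a \<Rightarrow> real) \<Rightarrow> 'a \<Rightarrow> 'a \<Rightarrow> 'a \<Rightarrow> real" where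
  "interaction M X Y x s y =
     (signed_excess M X Y x y - signed_excess M X Y s y) * kernel_gap M X Y x s"

lemma signed_excess_ordered:
  assumes "X y < X x" "Y y < Y x" "0 \<le> M"
  shows "signed_excess M X Y x y = clip ((Y x - Y y) - M * (X x - X y))"
  using assms by (simp add: signed_excess_def excess_def clip_nonpos)

lemma kernel_gap_swap: "kernel_gap M X Y s x = - kernel_gap M X Y x s"
  unfolding kernel_gap_def by (simp add: divide_simps) (simp add: algebra_simps)

lemma interaction_swap: "interaction M X Y s x y = interaction M X Y x s y"
  by (simp add: interaction_def kernel_gap_swap[of M X Y s x] algebra_simps)

lemma interaction_le_4:
  assumes M: "0 < M" and X: "X s < X x" and Y: "Y s < Y x"
  shows "interaction M X Y x s y \<le> 4"
proof -
  let ?d = "signed_excess M X Y x y - signed_excess M X Y s y"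
  have "?d / (Y x - Y s) \<le> 2"
    using signed_excess_increment(2)[of M X s x Y y] assms by (simp add: pos_divide_le_eq)
  moreover have "- 2 \<le> ?d / (M * (X x - X s))"
    using signed_excess_increment(1)[of M X s x Y y] assms by (subst pos_le_divide_eq) (simp_all add: algebra_simps)
  ultimately show ?thesis by (simp add: interaction_def kernel_gap_def right_diff_distrib)
qed

text \<open>
  The algebraic heart of the argument. For \<open>x\<^sub>1 < x\<^sub>2 < x\<^sub>3\<close>, the numbers \<open>a\<close> and \<open>b\<close> are the increments of
  \<open>Y - M X\<close> from \<open>x\<^sub>1\<close> to \<open>x\<^sub>2\<close> and from \<open>x\<^sub>2\<close> to \<open>x\<^sub>3\<close>, and \<open>k\<^sub>i\<^sub>j = 1 / (M (X\<^sub>i - X\<^sub>j) (Y\<^sub>i - Y\<^sub>j))\<close>. The first two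
  summands are nonnegative by monotonicity of \<open>F\<close>. The third can be negative only if \<open>a + b < 0\<close>; then \<open>F\<close>
  vanishes at \<open>a + b\<close> and at one of \<open>a\<close>, \<open>b\<close>, and since nearer points have larger weights, the remaining
  summand outweighs it.
\<close>

lemma three_point_inequality:
  fixes a b k21 k32 k31 :: real
  assumes F: "\<And>r r'. r \<le> r' \<Longrightarrow> F r \<le> F r'" "\<And>r. 0 \<le> F r" "\<And>r. r \<le> 0 \<Longrightarrow> F r = 0"
    and k: "0 \<le> k31" "k31 \<le> k21" "k31 \<le> k32"
  shows "0 \<le> b * k32 * (F (a + b) - F a) + a * k21 * (F (a + b) - F b) + (a + b) * k31 * (F a + F b)"
proof -
  have 1: "0 \<le> b * k32 * (F (a + b) - F a)"
    using F(1)[of a "a+b"] F(1)[of "a+b" a] k by (cases "b \<ge> 0") (auto intro!: mult_nonneg_nonneg mult_nonpos_nonpos mult_nonpos_nonneg)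
  have 2: "0 \<le> a * k21 * (F (a + b) - F b)"
    using F(1)[of b "a+b"] F(1)[of "a+b" b] k by (cases "a \<ge> 0") (auto intro!: mult_nonneg_nonneg mult_nonpos_nonpos mult_nonpos_nonneg)
  show ?thesis
  proof (cases "a + b \<ge> 0")
    case True
    hence "0 \<le> (a + b) * k31 * (F a + F b)" using F(2)[of a] F(2)[of b] k by (intro mult_nonneg_nonneg) auto
    thus ?thesis using 1 2 by linarith
  next
    case False
    hence z: "F (a + b) = 0" using F(3) by simp
    consider "a \<le> 0" "b \<le> 0" | "a > 0" "b \<le> 0" | "a \<le> 0" "b > 0" using False by linarith
    thus ?thesis
    proof cases
      case 1
      thus ?thesis using z F(3) by simp
    next
      case 2
      have "0 \<le> ((- b) * (k32 - k31) + a * k31) * F a"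
        using 2 k F(2)[of a] by (intro mult_nonneg_nonneg add_nonneg_nonneg) auto
      thus ?thesis using 2 z F(3)[of b] by (simp add: algebra_simps)
    next
      case 3
      have "0 \<le> ((- a) * (k21 - k31) + b * k31) * F b"
        using 3 k F(2)[of b] by (intro mult_nonneg_nonneg add_nonneg_nonneg) auto
      thus ?thesis using 3 z F(3)[of a] by (simp add: algebra_simps)
    qed
  qed
qed

lemma interaction_cyclic_sum_sorted:
  assumes M: "0 < M" and X: "X x < X s" "X s < X y" and Y: "Y x < Y s" "Y s < Y y"
  shows "interaction M X Y x s y + interaction M X Y s y x + interaction M X Y y x s \<le> 0"
proof -
  define a where "a = (Y s - Y x) - M * (X s - X x)"
  define b where "b = (Y y - Y s) - M * (X y - X s)"
  define k where "k p q = 1 / (M * (X q - X p) * (Y q - Y p))" for p q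
  have ab: "a + b = (Y y - Y x) - M * (X y - X x)" by (simp add: a_def b_def algebra_simps)
  have se: "signed_excess M X Y x s = - clip a" "signed_excess M X Y s x = clip a"
    "signed_excess M X Y s y = - clip b" "signed_excess M X Y y s = clip b"
    "signed_excess M X Y x y = - clip (a + b)" "signed_excess M X Y y x = clip (a + b)"
    using signed_excess_ordered[of X x s Y M] signed_excess_ordered[of X s y Y M]
      signed_excess_ordered[of X x y Y M] X Y M
    unfolding a_def b_def ab[unfolded a_def b_def]
    by (simp_all add: signed_excess_swap[of M X Y s x] signed_excess_swap[of M X Y y s] signed_excess_swap[of M X Y y x])
       
  have kg: "kernel_gap M X Y q p = - ((Y q - Y p) - M * (X q - X p)) * k p q"
    if "X p < X q" "Y p < Y q" for p q
  proof -
    have "X q - X p > 0" "Y q - Y p > 0" using that by auto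
    thus ?thesis using M unfolding kernel_gap_def k_def by (simp add: divide_simps)
  qed
  have g: "kernel_gap M X Y x s = a * k x s" "kernel_gap M X Y s y = b * k s y"
    "kernel_gap M X Y y x = - (a + b) * k x y"
    using kg[of x s] kg[of s y] kg[of x y] X Y
    by (simp_all add: kernel_gap_swap[of M X Y x s] kernel_gap_swap[of M X Y s y] ab) (simp_all add: a_def b_def algebra_simps)
  have "k x y \<le> k x s" "k x y \<le> k s y"
    using M X Y unfolding k_def by (intro divide_left_mono mult_mono mult_pos_pos; simp)+
  moreover have "0 \<le> k x y" using M X Y unfolding k_def by simp
  ultimately have k: "0 \<le> k x y" "k x y \<le> k x s" "k x y \<le> k s y" by simp_all
  from three_point_inequality[of clip, OF clip_mono clip_nonneg clip_nonpos k, of b a]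
  show ?thesis unfolding interaction_def se g by (simp add: algebra_simps)
qed

text \<open>
  The sum is invariant under permutations of the three points: cyclically by construction,
  and under transpositions because the interaction is symmetric in its first two points.
\<close>

lemma interaction_cyclic_sum:
  assumes M: "0 < M" and como: "\<And>x s. X s < X x \<Longrightarrow> Y s \<le> Y x"
    and "X x \<noteq> X s" "X s \<noteq> X y" "X x \<noteq> X y" "Y x \<noteq> Y s" "Y s \<noteq> Y y" "Y x \<noteq> Y y"
  shows "interaction M X Y x s y + interaction M X Y s y x + interaction M X Y y x s \<le> 0"
proof -
  have st: "Y p < Y q" if "X p < X q" "Y p \<noteq> Y q" for p q using como[OF that(1)] that by simp
  note sorted = interaction_cyclic_sum_sorted[OF M, of X _ _ _ Y]
  consider "X x < X s" "X s < X y" | "X x < X y" "X y < X s" | "X s < X x" "X x < X y"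
    | "X s < X y" "X y < X x" | "X y < X x" "X x < X s" | "X y < X s" "X s < X x"
    using assms(3-5) by linarith
  thus ?thesis
  proof cases
    case 1 thus ?thesis using sorted[of x s y] st assms by auto
  next
    case 2 thus ?thesis using sorted[of x y s] st[of x y] st[of y s] assms
      by (simp add: interaction_swap[of M X Y x y] interaction_swap[of M X Y y s] interaction_swap[of M X Y s x])
  next
    case 3 thus ?thesis using sorted[of s x y] st[of s x] st[of x y] assms
      by (simp add: interaction_swap[of M X Y s x] interaction_swap[of M X Y x y] interaction_swap[of M X Y y s])
  next
    case 4 thus ?thesis using sorted[of s y x] st[of s y] st[of y x] assms by simp
  next
    case 5 thus ?thesis using sorted[of y x s] st[of y x] st[of x s] assms by simp
  next
    case 6 thus ?thesis using sorted[of y s x] st[of y s] st[of s x] assms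
      by (simp add: interaction_swap[of M X Y y s] interaction_swap[of M X Y s x] interaction_swap[of M X Y x y])
  qed
qed

section \<open>Comparison of two comonotone coordinates\<close>

lemma nn_integral_triple:
  assumes "prob_space M" and [measurable]: "h \<in> borel_measurable (M \<Otimes>\<^sub>M M \<Otimes>\<^sub>M M)"
  shows "(\<integral>\<^sup>+x. \<integral>\<^sup>+s. \<integral>\<^sup>+y. h (x, s, y) \<partial>M \<partial>M \<partial>M) = integral\<^sup>N (M \<Otimes>\<^sub>M M \<Otimes>\<^sub>M M) h"
proof -
  interpret prob_space M by fact
  interpret P: pair_prob_space M M ..
  have "(\<integral>\<^sup>+x. \<integral>\<^sup>+s. \<integral>\<^sup>+y. h (x, s, y) \<partial>M \<partial>M \<partial>M) = (\<integral>\<^sup>+x. \<integral>\<^sup>+q. h (x, q) \<partial>(M \<Otimes>\<^sub>M M) \<partial>M)"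
    by (intro nn_integral_cong nn_integral_fst) measurable
  also have "\<dots> = integral\<^sup>N (M \<Otimes>\<^sub>M M \<Otimes>\<^sub>M M) h"
    by (rule P.nn_integral_fst) measurable
  finally show ?thesis .
qed

lemma nn_integral_rotate:
  assumes M: "prob_space M" and h [measurable]: "h \<in> borel_measurable (M \<Otimes>\<^sub>M M \<Otimes>\<^sub>M M)"
  shows "(\<integral>\<^sup>+(x, s, y). h (s, y, x) \<partial>(M \<Otimes>\<^sub>M M \<Otimes>\<^sub>M M)) = integral\<^sup>N (M \<Otimes>\<^sub>M M \<Otimes>\<^sub>M M) h"
proof -
  interpret prob_space M by fact
  interpret P: pair_prob_space M M ..
  have m1: "(\<lambda>(x, s). \<integral>\<^sup>+y. h (s, y, x) \<partial>M) \<in> borel_measurable (M \<Otimes>\<^sub>M M)"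
    by measurable
  have m2: "(\<lambda>(y, x). h (s, y, x)) \<in> borel_measurable (M \<Otimes>\<^sub>M M)" if "s \<in> space M" for s
    using that by measurable
  have "(\<integral>\<^sup>+(x, s, y). h (s, y, x) \<partial>(M \<Otimes>\<^sub>M M \<Otimes>\<^sub>M M)) = (\<integral>\<^sup>+x. \<integral>\<^sup>+s. \<integral>\<^sup>+y. h (s, y, x) \<partial>M \<partial>M \<partial>M)"
    by (subst nn_integral_triple[OF M, symmetric]) auto
  also have "\<dots> = (\<integral>\<^sup>+s. \<integral>\<^sup>+x. \<integral>\<^sup>+y. h (s, y, x) \<partial>M \<partial>M \<partial>M)"
    using P.Fubini'[OF m1] by simp
  also have "\<dots> = (\<integral>\<^sup>+s. \<integral>\<^sup>+y. \<integral>\<^sup>+x. h (s, y, x) \<partial>M \<partial>M \<partial>M)"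
    by (rule nn_integral_cong) (rule P.Fubini'[OF m2])
  also have "\<dots> = integral\<^sup>N (M \<Otimes>\<^sub>M M \<Otimes>\<^sub>M M) h" by (rule nn_integral_triple[OF M h])
  finally show ?thesis .
qed

text \<open>
  Test the two first variations with \<open>\<psi> x = \<integral> a(x, y) d\<eta>(y)\<close> for the signed excess \<open>a\<close>. Subtracting gives
  \<open>\<integral> (g - f / M) \<psi> \<le> I\<close>, where \<open>I\<close> is the integral of the interaction over three independent points. Rotating the
  points does not change \<open>I\<close>, and the cyclic sum is nonpositive, so \<open>I \<le> 0\<close>. By antisymmetry of \<open>a\<close> the left side is half
  the integral of \<open>((g - f / M) x - (g - f / M) y) a(x, y)\<close>, whose integrand is positive where \<open>a\<close> does not vanish.
  So \<open>a = 0\<close> almost everywhere, which is the claim.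

  The statement is symmetric enough to be used in both directions, with the roles of \<open>X\<close> and \<open>Y\<close> exchanged.
\<close>

lemma comonotone_comparison:
  fixes X Y f g :: "'a \<Rightarrow> real"
  assumes pr: "prob_space \<eta>" and sp: "space \<eta> = UNIV"
    and [measurable]: "X \<in> borel_measurable \<eta>" "Y \<in> borel_measurable \<eta>"
    and M: "M > 0"
    and como: "\<And>x s. X s < X x \<Longrightarrow> Y s \<le> Y x"
    and off: "AE p in \<eta> \<Otimes>\<^sub>M \<eta>. X (fst p) \<noteq> X (snd p) \<and> Y (fst p) \<noteq> Y (snd p)"
    and fX: "first_variation_bound \<eta> X f" and gY: "first_variation_bound \<eta> Y g"
    and f: "integrable \<eta> f" and g: "integrable \<eta> g"
    and strict: "AE p in \<eta> \<Otimes>\<^sub>M \<eta>. M * \<bar>X (fst p) - X (snd p)\<bar> < \<bar>Y (fst p) - Y (snd p)\<bar> \<longrightarrow>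
       0 < ((g (fst p) - f (fst p) / M) - (g (snd p) - f (snd p) / M)) * (Y (fst p) - Y (snd p))"
  shows "AE p in \<eta> \<Otimes>\<^sub>M \<eta>. \<bar>Y (fst p) - Y (snd p)\<bar> \<le> M * \<bar>X (fst p) - X (snd p)\<bar>"
proof -
  interpret prob_space \<eta> by fact
  interpret P: pair_prob_space \<eta> \<eta> ..
  interpret Q: pair_prob_space \<eta> "\<eta> \<Otimes>\<^sub>M \<eta>" ..
  let ?P = "\<eta> \<Otimes>\<^sub>M \<eta>" and ?Q = "\<eta> \<Otimes>\<^sub>M \<eta> \<Otimes>\<^sub>M \<eta>"
  have [measurable]: "f \<in> borel_measurable \<eta>" "g \<in> borel_measurable \<eta>" using f g by simp_all
  have como': "X s \<le> X x" if "Y s < Y x" for x s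
    by (rule ccontr) (use como[of x s] that in auto)
  let ?a = "signed_excess M X Y"
  have a1: "?a x y \<le> 1" "- 1 \<le> ?a x y" for x y
    using abs_signed_excess_le_1[of M X Y x y] by (simp_all add: abs_le_iff)
  have am [measurable]: "?a x \<in> borel_measurable \<eta>" for x
    by (rule measurable_signed_excess[where f = "\<lambda>_. x" and g = "\<lambda>y. y" and M = \<eta>]) (simp_all add: sp)
  have ia: "integrable \<eta> (?a x)" for x
    by (intro integrable_const_bound[where B = 1]) (simp_all add: abs_signed_excess_le_1)
  define \<psi> where "\<psi> x = (\<integral>y. ?a x y \<partial>\<eta>)" for x
  have [measurable]: "\<psi> \<in> borel_measurable \<eta>" unfolding \<psi>_def by measurable
  have \<psi>1: "\<bar>\<psi> x\<bar> \<le> 1" for x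
  proof -
    have "\<psi> x \<le> 1" "- 1 \<le> \<psi> x"
      using integral_mono[OF ia[of x], of "\<lambda>_. 1"] integral_mono[OF _ ia[of x], of "\<lambda>_. - 1"] a1
      by (simp_all add: \<psi>_def prob_space)
    thus ?thesis by (simp add: abs_le_iff)
  qed
  have \<psi>d: "\<psi> x - \<psi> s = (\<integral>y. ?a x y - ?a s y \<partial>\<eta>)" for x s
    unfolding \<psi>_def using ia by simp
  have os1: "one_sided_lipschitz (2 * M) X \<psi>"
    unfolding one_sided_lipschitz_def
  proof (intro allI impI)
    fix x s assume l: "X s < X x"
    have "(\<integral>y. - (2 * M) * (X x - X s) \<partial>\<eta>) \<le> \<psi> x - \<psi> s"
      unfolding \<psi>d using ia M l como[OF l] by (intro integral_mono signed_excess_increment) auto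
    thus "- (2 * M) * (X x - X s) \<le> \<psi> x - \<psi> s" by (simp add: prob_space)
  qed
  have os2: "one_sided_lipschitz 2 Y (\<lambda>x. - \<psi> x)"
    unfolding one_sided_lipschitz_def
  proof (intro allI impI)
    fix x s assume l: "Y s < Y x"
    have "\<psi> x - \<psi> s \<le> (\<integral>y. 2 * (Y x - Y s) \<partial>\<eta>)"
      unfolding \<psi>d using ia M l como'[OF l] by (intro integral_mono signed_excess_increment) auto
    thus "- 2 * (Y x - Y s) \<le> - \<psi> x - - \<psi> s" by (simp add: prob_space)
  qed
  let ?q1 = "pair_quotient \<psi> X" and ?q2 = "pair_quotient \<psi> Y"
  have q1: "integrable ?P ?q1" "integral\<^sup>L ?P ?q1 \<le> (\<integral>x. f x * \<psi> x \<partial>\<eta>)"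
    using fX[unfolded first_variation_bound_def, rule_format, of \<psi> 1 "2 * M"] \<psi>1 os1 by auto
  have "pair_quotient (\<lambda>x. - \<psi> x) Y = (\<lambda>p. - ?q2 p)"
    by (simp add: pair_quotient_def fun_eq_iff minus_divide_left)
  hence "integrable ?P (\<lambda>p. - ?q2 p) \<and> (\<integral>p. - ?q2 p \<partial>?P) \<le> (\<integral>x. g x * - \<psi> x \<partial>\<eta>)"
    using gY[unfolded first_variation_bound_def, rule_format, of "\<lambda>x. - \<psi> x" 1 2] \<psi>1 os2 by auto
  hence q2: "integrable ?P ?q2" "(\<integral>x. g x * \<psi> x \<partial>\<eta>) \<le> integral\<^sup>L ?P ?q2" by auto
  define I where "I = (\<integral>p. ?q2 p - ?q1 p / M \<partial>?P)"
  have I: "I = integral\<^sup>L ?P ?q2 - integral\<^sup>L ?P ?q1 / M" unfolding I_def using q1 q2 by simp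

  have le4: "interaction M X Y x s y \<le> 4" if "X x \<noteq> X s" "Y x \<noteq> Y s" for x s y
  proof (cases "X s < X x")
    case True
    with como[OF True] that show ?thesis by (intro interaction_le_4[OF M]) auto
  next
    case False
    hence "X x < X s" using that by simp
    with como[OF this] that show ?thesis
      unfolding interaction_swap[of M X Y x s] by (intro interaction_le_4[OF M]) auto
  qed
  \<comment> \<open>the interaction is at most \<open>4\<close>, so the triple integral is that of a nonnegative function and may be rotated\<close>
  define H where "H z = ennreal (4 - interaction M X Y (fst z) (fst (snd z)) (snd (snd z)))" for z
  have H [measurable]: "H \<in> borel_measurable ?Q"
    unfolding H_def interaction_def kernel_gap_def by measurable
  have off2: "AE x in \<eta>. AE s in \<eta>. X x \<noteq> X s \<and> Y x \<noteq> Y s"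
    using P.AE_pair[OF off] by simp
  have N: "integral\<^sup>N ?Q H = ennreal (4 - I)"
  proof -
    have "integral\<^sup>N ?Q H = (\<integral>\<^sup>+x. \<integral>\<^sup>+s. \<integral>\<^sup>+y. H (x, s, y) \<partial>\<eta> \<partial>\<eta> \<partial>\<eta>)"
      by (rule nn_integral_triple[OF pr H, symmetric])
    also have "\<dots> = (\<integral>\<^sup>+x. \<integral>\<^sup>+s. ennreal (4 - (?q2 (x, s) - ?q1 (x, s) / M)) \<partial>\<eta> \<partial>\<eta>)"
      using off2
    proof (intro nn_integral_cong_AE, eventually_elim)
      case (elim x)
      thus ?case
      proof (intro nn_integral_cong_AE, eventually_elim)
        case (elim s)
        have i: "integrable \<eta> (\<lambda>y. 4 - interaction M X Y x s y)"
          unfolding interaction_def using ia by simp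
        have "(\<integral>\<^sup>+y. H (x, s, y) \<partial>\<eta>) = ennreal (\<integral>y. 4 - interaction M X Y x s y \<partial>\<eta>)"
          unfolding H_def using i le4 elim by (simp add: nn_integral_eq_integral)
        also have "(\<integral>y. 4 - interaction M X Y x s y \<partial>\<eta>) = 4 - (\<psi> x - \<psi> s) * kernel_gap M X Y x s"
          unfolding interaction_def \<psi>d using ia by (simp add: prob_space)
        also have "\<dots> = 4 - (?q2 (x, s) - ?q1 (x, s) / M)"
          by (simp add: pair_quotient_def kernel_gap_def right_diff_distrib mult.commute)
        finally show ?case .
      qed
    qed
    also have "\<dots> = (\<integral>\<^sup>+p. ennreal (4 - (?q2 p - ?q1 p / M)) \<partial>?P)"
      by (rule nn_integral_fst) measurable
    also have "\<dots> = ennreal (\<integral>p. 4 - (?q2 p - ?q1 p / M) \<partial>?P)"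
    proof (rule nn_integral_eq_integral)
      show "integrable ?P (\<lambda>p. 4 - (?q2 p - ?q1 p / M))" using q1 q2 by simp
      show "AE p in ?P. 0 \<le> 4 - (?q2 p - ?q1 p / M)"
        using off
      proof eventually_elim
        case (elim p)
        obtain x s where p: "p = (x, s)" by force
        have "?q2 p - ?q1 p / M = (\<psi> x - \<psi> s) * kernel_gap M X Y x s"
          by (simp add: p pair_quotient_def kernel_gap_def right_diff_distrib mult.commute)
        also have "\<dots> = (\<integral>y. interaction M X Y x s y \<partial>\<eta>)"
          unfolding interaction_def \<psi>d using ia by simp
        also have "\<dots> \<le> (\<integral>y. 4 \<partial>\<eta>)"
          using le4 elim ia by (intro integral_mono) (auto simp: p interaction_def)
        finally show ?case by (simp add: prob_space)
      qed
    qed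
    also have "(\<integral>p. 4 - (?q2 p - ?q1 p / M) \<partial>?P) = 4 - I"
      unfolding I_def using q1 q2 by (simp add: P.prob_space)
    finally show ?thesis .
  qed
  have I0: "I \<le> 0"
  proof -
    let ?H2 = "\<lambda>(x, s, y). H (s, y, x)" and ?H3 = "\<lambda>(x, s, y). H (y, x, s)"
    have H2 [measurable]: "?H2 \<in> borel_measurable ?Q" by measurable
    have H3 [measurable]: "?H3 \<in> borel_measurable ?Q" by measurable
    have n2: "integral\<^sup>N ?Q ?H2 = integral\<^sup>N ?Q H" by (rule nn_integral_rotate[OF pr H])
    have n3: "integral\<^sup>N ?Q ?H3 = integral\<^sup>N ?Q H"
      using nn_integral_rotate[OF pr H2] n2 by simp
    have dist: "AE z in ?Q. (X (fst z) \<noteq> X (fst (snd z)) \<and> Y (fst z) \<noteq> Y (fst (snd z))) \<and>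
        (X (fst (snd z)) \<noteq> X (snd (snd z)) \<and> Y (fst (snd z)) \<noteq> Y (snd (snd z))) \<and>
        (X (fst z) \<noteq> X (snd (snd z)) \<and> Y (fst z) \<noteq> Y (snd (snd z)))"
    proof (rule Q.AE_pair_measure)
      show "AE x in \<eta>. AE q in ?P. (X (fst (x, q)) \<noteq> X (fst (snd (x, q))) \<and> Y (fst (x, q)) \<noteq> Y (fst (snd (x, q)))) \<and>
        (X (fst (snd (x, q))) \<noteq> X (snd (snd (x, q))) \<and> Y (fst (snd (x, q))) \<noteq> Y (snd (snd (x, q)))) \<and>
        (X (fst (x, q)) \<noteq> X (snd (snd (x, q))) \<and> Y (fst (x, q)) \<noteq> Y (snd (snd (x, q))))"
        using off2
      proof eventually_elim
        case (elim x)
        from AE_pair_coordinates[OF pr elim] off show ?case by eventually_elim simp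
      qed
    qed measurable
    have "12 = (\<integral>\<^sup>+z. 12 \<partial>?Q)" by (simp add: Q.emeasure_space_1)
    also have "\<dots> \<le> (\<integral>\<^sup>+z. H z + ?H2 z + ?H3 z \<partial>?Q)"
      using dist
    proof (intro nn_integral_mono_AE, eventually_elim)
      case (elim z)
      obtain x s y where z: "z = (x, s, y)" by (metis prod.exhaust)
      have le: "interaction M X Y x s y \<le> 4" "interaction M X Y s y x \<le> 4" "interaction M X Y y x s \<le> 4"
        using elim by (auto simp: z intro!: le4)
      have "interaction M X Y x s y + interaction M X Y s y x + interaction M X Y y x s \<le> 0"
        using elim by (intro interaction_cyclic_sum[OF M como]) (auto simp: z)
      hence "ennreal 12 \<le> ennreal ((4 - interaction M X Y x s y) + (4 - interaction M X Y s y x) + (4 - interaction M X Y y x s))"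
        by (intro ennreal_leI) simp
      also have "\<dots> = H z + ?H2 z + ?H3 z"
        using le by (subst ennreal_plus, simp, simp, subst ennreal_plus) (simp_all add: H_def z)
      finally show ?case by simp
    qed
    also have "\<dots> = integral\<^sup>N ?Q H + integral\<^sup>N ?Q ?H2 + integral\<^sup>N ?Q ?H3"
      by (simp add: nn_integral_add)
    also have "\<dots> = ennreal (4 - I) + ennreal (4 - I) + ennreal (4 - I)" by (simp only: n2 n3 N)
    finally have *: "ennreal 12 \<le> ennreal (4 - I) + ennreal (4 - I) + ennreal (4 - I)" by simp
    show ?thesis
    proof (cases "4 - I \<ge> 0")
      case True
      hence "ennreal 12 \<le> ennreal ((4 - I) + (4 - I) + (4 - I))" using * by (simp only: ennreal_plus add_nonneg_nonneg)
      with True show ?thesis by (subst (asm) ennreal_le_iff) auto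
    next
      case False
      with * show ?thesis by (simp add: ennreal_neg)
    qed
  qed

  define h where "h x = g x - f x / M" for x
  have h: "integrable \<eta> h" unfolding h_def using f g by simp
  have [measurable]: "h \<in> borel_measurable \<eta>" using h by simp
  have times_\<psi>: "integrable \<eta> (\<lambda>x. w x * \<psi> x)" if "integrable \<eta> w" for w
  proof (rule Bochner_Integration.integrable_bound[OF that])
    have [measurable]: "w \<in> borel_measurable \<eta>" using that by simp
    show "(\<lambda>x. w x * \<psi> x) \<in> borel_measurable \<eta>" by measurable
    show "AE x in \<eta>. norm (w x * \<psi> x) \<le> norm (w x)" using \<psi>1 by (auto simp: abs_mult intro!: mult_left_le)
  qed
  have "(\<integral>x. h x * \<psi> x \<partial>\<eta>) = (\<integral>x. g x * \<psi> x - f x * \<psi> x / M \<partial>\<eta>)"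
    by (simp add: h_def left_diff_distrib)
  also have "\<dots> = (\<integral>x. g x * \<psi> x \<partial>\<eta>) - (\<integral>x. f x * \<psi> x \<partial>\<eta>) / M"
    using times_\<psi>[OF f] times_\<psi>[OF g] by simp
  also have "\<dots> \<le> I" unfolding I using q1(2) q2(2) M by (intro diff_mono divide_right_mono) auto
  finally have h\<psi>: "(\<integral>x. h x * \<psi> x \<partial>\<eta>) \<le> 0" using I0 by simp
  let ?A = "\<lambda>p. ?a (fst p) (snd p)"
  note hh = pair_coordinate_integrals[OF pr h]
  have ib: "integrable ?P (\<lambda>p. w p * ?A p)" if "integrable ?P w" for w
  proof (rule Bochner_Integration.integrable_bound[OF that])
    have [measurable]: "w \<in> borel_measurable ?P" using that by simp
    show "(\<lambda>p. w p * ?A p) \<in> borel_measurable ?P" by measurable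
    show "AE p in ?P. norm (w p * ?A p) \<le> norm (w p)"
      by (rule AE_I2) (simp add: abs_mult mult_left_le abs_signed_excess_le_1)
  qed
  have J1: "(\<integral>p. h (fst p) * ?A p \<partial>?P) = (\<integral>x. h x * \<psi> x \<partial>\<eta>)"
    using P.integral_fst'[OF ib[OF hh(1)]] by (simp add: \<psi>_def)
  have J2: "(\<integral>p. h (snd p) * ?A p \<partial>?P) = - (\<integral>x. h x * \<psi> x \<partial>\<eta>)"
  proof -
    have "(\<integral>p. h (snd p) * ?a (snd p) (fst p) \<partial>?P) = (\<integral>x. h x * \<psi> x \<partial>\<eta>)"
      using P.integral_product_swap[of "\<lambda>p. h (fst p) * ?A p"] J1 by (simp add: case_prod_beta')
    moreover have "(\<lambda>p. h (snd p) * ?a (snd p) (fst p)) = (\<lambda>p. - (h (snd p) * ?A p))"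
      by (rule ext, subst signed_excess_swap, simp)
    ultimately show ?thesis by simp
  qed
  let ?D = "\<lambda>p. (h (fst p) - h (snd p)) * ?A p"
  have iD: "integrable ?P ?D" using hh by (intro ib) simp
  have "integral\<^sup>L ?P ?D = (\<integral>p. h (fst p) * ?A p \<partial>?P) - (\<integral>p. h (snd p) * ?A p \<partial>?P)"
    using ib[OF hh(1)] ib[OF hh(2)] by (simp add: left_diff_distrib)
  hence D0: "integral\<^sup>L ?P ?D \<le> 0" using J1 J2 h\<psi> by simp
  have Dcases: "AE p in ?P. 0 \<le> ?D p \<and> (?D p = 0 \<longrightarrow> \<bar>Y (fst p) - Y (snd p)\<bar> \<le> M * \<bar>X (fst p) - X (snd p)\<bar>)"
    using off strict
  proof eventually_elim
    case (elim p)
    obtain x y where p: "p = (x, y)" by force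
    have ne: "X x \<noteq> X y" "Y x \<noteq> Y y" using elim(1) by (auto simp: p)
    have main: "0 \<le> (h x - h y) * ?a x y \<and> ((h x - h y) * ?a x y = 0 \<longrightarrow> Y x - Y y \<le> M * (X x - X y))"
      if l: "X y < X x" and s: "M * \<bar>X x - X y\<bar> < \<bar>Y x - Y y\<bar> \<longrightarrow> 0 < (h x - h y) * (Y x - Y y)"
        and "Y x \<noteq> Y y" for x y
    proof -
      have Y: "Y y < Y x" using como[OF l] that by simp
      have a: "?a x y = clip ((Y x - Y y) - M * (X x - X y))"
        using l Y M by (intro signed_excess_ordered) auto
      show ?thesis
      proof (cases "M * (X x - X y) < Y x - Y y")
        case True
        hence "0 < h x - h y" using s l Y by (simp add: zero_less_mult_iff)
        moreover have "0 < ?a x y" using True by (simp add: a clip_pos_iff)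
        ultimately have "0 < (h x - h y) * ?a x y" by simp
        thus ?thesis by auto
      next
        case False
        thus ?thesis by (simp add: a clip_nonpos)
      qed
    qed
    show ?case
    proof (cases "X y < X x")
      case True
      thus ?thesis using main[OF True] elim ne como[OF True] by (simp add: p h_def)
    next
      case False
      hence l: "X x < X y" using ne by simp
      have "(h x - h y) * ?a x y = (h y - h x) * ?a y x"
        by (simp add: signed_excess_swap[of M X Y x y] algebra_simps)
      moreover have "(h x - h y) * (Y x - Y y) = (h y - h x) * (Y y - Y x)" by (simp add: algebra_simps)
      ultimately show ?thesis using main[OF l] elim ne como[OF l] l
        by (simp add: p h_def abs_minus_commute[of "X x"] abs_minus_commute[of "Y x"])
    qed
  qed
  have "0 \<le> integral\<^sup>L ?P ?D" using Dcases by (intro integral_nonneg_AE) (auto elim: eventually_mono)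
  with D0 have "integral\<^sup>L ?P ?D = 0" by simp
  hence "AE p in ?P. ?D p = 0"
    using integral_nonneg_eq_0_iff_AE[OF iD] Dcases by (auto elim: eventually_mono)
  with Dcases show ?thesis by eventually_elim auto
qed

section \<open>Points of the support\<close>

text \<open>
  Neighbourhoods of two points of the support have a product of positive measure, so almost sure
  properties of pairs are witnessed near every pair of support points.
\<close>

lemma measure_support_pair_witness:
  assumes \<eta>: "borel_prob \<eta>" and Q: "AE p in \<eta> \<Otimes>\<^sub>M \<eta>. Q p"
    and x: "x \<in> measure_support \<eta>" "open U" "x \<in> U" and y: "y \<in> measure_support \<eta>" "open V" "y \<in> V"
  shows "\<exists>a\<in>U. \<exists>b\<in>V. Q (a, b)"
proof (rule ccontr)
  interpret prob_space \<eta> using \<eta> by (simp add: borel_prob_def)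
  have [measurable]: "U \<in> sets \<eta>" "V \<in> sets \<eta>" using x y \<eta> by (simp_all add: borel_prob_def)
  assume "\<not> ?thesis"
  hence "AE p in \<eta> \<Otimes>\<^sub>M \<eta>. p \<notin> U \<times> V" using Q by (auto elim!: eventually_mono)
  hence "emeasure (\<eta> \<Otimes>\<^sub>M \<eta>) (U \<times> V) = 0"
    by (subst (asm) AE_iff_null_sets[symmetric]) auto
  hence "emeasure \<eta> U * emeasure \<eta> V = 0" by (simp add: emeasure_pair_measure_Times)
  moreover have "emeasure \<eta> U > 0" "emeasure \<eta> V > 0" using x y by (auto simp: measure_support_def)
  ultimately show False by auto
qed

lemma measure_support_pair_in_closed:
  assumes \<eta>: "borel_prob \<eta>" and Q: "AE p in \<eta> \<Otimes>\<^sub>M \<eta>. p \<in> S" and S: "closed S"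
    and "x \<in> measure_support \<eta>" "y \<in> measure_support \<eta>"
  shows "(x, y) \<in> S"
proof (rule ccontr)
  assume "(x, y) \<notin> S"
  then obtain U V where UV: "open U" "open V" "(x, y) \<in> U \<times> V" "U \<times> V \<subseteq> - S"
    using open_prod_elim[of "- S" "(x, y)"] S by (auto simp: open_Compl)
  from measure_support_pair_witness[OF \<eta> Q assms(4) UV(1) _ assms(5) UV(2)] UV(3,4)
  show False by auto
qed

lemma measure_support_complement:
  "- measure_support \<mu> = \<Union> {U. open U \<and> emeasure \<mu> U = 0}"
  by (auto simp: measure_support_def)

lemma closed_measure_support: "closed (measure_support \<mu>)"
  unfolding closed_def measure_support_complement by auto

text \<open>
  The line is Lindeloef: countably many null open sets cover the complement of the support.
\<close>

lemma AE_measure_support: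
  assumes "sets \<mu> = sets borel"
  shows "AE x in \<mu>. x \<in> measure_support \<mu>"
proof -
  obtain F where F: "F \<subseteq> {U. open U \<and> emeasure \<mu> U = 0}" "countable F" "\<Union>F = - measure_support \<mu>"
    using Lindelof[of "{U. open U \<and> emeasure \<mu> U = 0}"] unfolding measure_support_complement by auto
  have "\<Union>F \<in> null_sets \<mu>"
    using F(1,2) assms by (intro null_sets_UN'[of F "\<lambda>U. U", simplified]) (auto simp: null_sets_def)
  thus ?thesis unfolding F(3) by (rule AE_I') auto
qed

text \<open>
  The support of \<open>\<eta>\<close> is compact, so its image under \<open>T\<close> is closed, and it carries the image measure.
\<close>

lemma measure_support_distr_subset:
  assumes \<eta>: "borel_prob \<eta>" and R: "AE x in \<eta>. \<bar>x\<bar> \<le> R" and T: "continuous_on UNIV T"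
    and y: "y \<in> measure_support (distr \<eta> borel T)"
  obtains x where "x \<in> measure_support \<eta>" "T x = y"
proof -
  interpret prob_space \<eta> using \<eta> by (simp add: borel_prob_def)
  have [measurable_cong]: "sets \<eta> = sets borel" and sp: "space \<eta> = UNIV"
    using \<eta> sets_eq_imp_space_eq[of \<eta> borel] by (simp_all add: borel_prob_def)
  have [measurable]: "T \<in> borel_measurable borel" using T by (rule borel_measurable_continuous_onI)
  let ?K = "measure_support \<eta> \<inter> {-R..R}"
  have ae: "AE x in \<eta>. x \<in> ?K"
    using AE_measure_support[of \<eta>] R \<eta> by (auto simp: borel_prob_def abs_le_iff elim!: eventually_elim2)
  have "compact ?K" using closed_measure_support by (intro closed_Int_compact) auto
  hence cl: "closed (T ` ?K)"
    by (intro compact_imp_closed compact_continuous_image continuous_on_subset[OF T]) auto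
  have "y \<in> T ` ?K"
  proof (rule ccontr)
    assume n: "y \<notin> T ` ?K"
    have o: "open (- (T ` ?K))" using cl by auto
    hence "emeasure (distr \<eta> borel T) (- (T ` ?K)) > 0" using y n by (auto simp: measure_support_def)
    moreover have "emeasure (distr \<eta> borel T) (- (T ` ?K)) = emeasure \<eta> (T -` (- (T ` ?K)))"
      using o by (subst emeasure_distr) (auto simp: sp)
    moreover have "emeasure \<eta> (T -` (- (T ` ?K))) = 0"
    proof -
      have "T -` (- (T ` ?K)) \<in> sets \<eta>"
        using measurable_sets[of T \<eta> borel "- (T ` ?K)"] o by (auto simp: sp)
      moreover have "AE x in \<eta>. x \<notin> T -` (- (T ` ?K))" using ae by eventually_elim auto
      ultimately show ?thesis by (subst (asm) AE_iff_null_sets[symmetric]) auto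
    qed
    ultimately show False by simp
  qed
  thus thesis using that by auto
qed

text \<open>
  Without atoms, every neighbourhood of a point of the support contains a pair of distinct points
  that satisfies the almost sure slope condition; the mean value theorem turns it into a condition on the
  derivative at a nearby point.
\<close>

lemma deriv_on_measure_support:
  fixes T :: "real \<Rightarrow> real"
  assumes \<eta>: "borel_prob \<eta>" and T: "\<And>x. T differentiable (at x)" "continuous_on UNIV (deriv T)"
    and Q: "AE p in \<eta> \<Otimes>\<^sub>M \<eta>. fst p \<noteq> snd p" "AE p in \<eta> \<Otimes>\<^sub>M \<eta>. \<bar>T (fst p) - T (snd p)\<bar> \<in> (\<lambda>c. c * \<bar>fst p - snd p\<bar>) ` C"
    and C: "closed C" and x: "x \<in> measure_support \<eta>"
  shows "\<bar>deriv T x\<bar> \<in> C"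
proof -
  have "\<bar>deriv T x\<bar> \<in> closure C"
  proof (subst closure_approachable, intro allI impI)
    fix e :: real assume "e > 0"
    moreover have "isCont (deriv T) x" using T(2) by (simp add: continuous_on_eq_continuous_at)
    ultimately obtain d where d: "d > 0" "\<And>z. dist z x < d \<Longrightarrow> dist (deriv T z) (deriv T x) < e"
      unfolding continuous_at_eps_delta by blast
    have "AE p in \<eta> \<Otimes>\<^sub>M \<eta>. fst p \<noteq> snd p \<and> \<bar>T (fst p) - T (snd p)\<bar> \<in> (\<lambda>c. c * \<bar>fst p - snd p\<bar>) ` C"
      using Q by eventually_elim auto
    from measure_support_pair_witness[OF \<eta> this x open_ball _ x open_ball, of x d x d] d(1)
    obtain a b c where ab: "a \<in> ball x d" "b \<in> ball x d" "a \<noteq> b" and c: "c \<in> C" "\<bar>T a - T b\<bar> = c * \<bar>a - b\<bar>"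
      by auto
    have "\<exists>z. dist z x < d \<and> \<bar>T a - T b\<bar> = \<bar>deriv T z\<bar> * \<bar>a - b\<bar>"
    proof -
      have mv: "\<exists>z. p < z \<and> z < q \<and> T q - T p = (q - p) * deriv T z" if "p < q" for p q
        using MVT2[OF that, of T "deriv T"] T(1) by (auto simp: DERIV_deriv_iff_real_differentiable)
      show ?thesis
      proof (cases "a < b")
        case True
        from mv[OF this] obtain z where "a < z" "z < b" "T b - T a = (b - a) * deriv T z" by auto
        thus ?thesis using ab by (intro exI[of _ z])
          (auto simp: dist_real_def abs_minus_commute[of "T a"] abs_minus_commute[of a] abs_mult mult.commute)
      next
        case False
        hence "b < a" using ab by simp
        from mv[OF this] obtain z where "b < z" "z < a" "T a - T b = (a - b) * deriv T z" by auto
        thus ?thesis using ab by (intro exI[of _ z]) (auto simp: dist_real_def abs_mult mult.commute)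
      qed
    qed
    then obtain z where z: "dist z x < d" "c * \<bar>a - b\<bar> = \<bar>deriv T z\<bar> * \<bar>a - b\<bar>" using c by auto
    hence "c = \<bar>deriv T z\<bar>" using ab by simp
    with d(2)[OF z(1)] c(1) show "\<exists>c\<in>C. dist c \<bar>deriv T x\<bar> < e"
      by (intro bexI[of _ c]) (auto simp: dist_real_def)
  qed
  thus ?thesis using C by simp
qed

section \<open>Derivative of the Legendre transform\<close>

lemma legendre_at_deriv:
  assumes "convex_on UNIV \<phi>" "\<And>x. \<phi> differentiable (at x)"
  shows "legendre \<phi> (deriv \<phi> x) = ereal (x * deriv \<phi> x - \<phi> x)"
  unfolding legendre_def
proof (rule antisym)
  show "(SUP z. ereal (z * deriv \<phi> x - \<phi> z)) \<le> ereal (x * deriv \<phi> x - \<phi> x)"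
  proof (rule SUP_least)
    fix z
    show "ereal (z * deriv \<phi> x - \<phi> z) \<le> ereal (x * deriv \<phi> x - \<phi> x)"
      using convex_tangent[OF assms, of x z] by (simp add: algebra_simps)
  qed
  show "ereal (x * deriv \<phi> x - \<phi> x) \<le> (SUP z. ereal (z * deriv \<phi> x - \<phi> z))"
    by (rule SUP_upper2[of x]) auto
qed

text \<open>
  Positivity of \<open>\<phi>''\<close> is essential: if \<open>\<phi>'\<close> were constant near \<open>x\<close>, the Legendre transform would
  have a corner at \<open>\<phi>' x\<close>. Otherwise \<open>y\<close> near \<open>\<phi>' x\<close> has the form \<open>\<phi>' a\<close> with \<open>a\<close> near \<open>x\<close>, and the tangent inequalities
  at \<open>x\<close> and \<open>a\<close> enclose the increment of the transform between \<open>x (y - \<phi>' x)\<close> and \<open>a (y - \<phi>' x)\<close>.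
\<close>

lemma legendre_deriv_at_deriv:
  assumes \<phi>: "convex_on UNIV \<phi>" "\<And>x. \<phi> differentiable (at x)"
    and T: "\<And>x. deriv \<phi> differentiable (at x)" and pos: "deriv (deriv \<phi>) x > 0"
  shows "legendre_deriv \<phi> (deriv \<phi> x) = x"
proof -
  let ?T = "deriv \<phi>" and ?L = "\<lambda>z. real_of_ereal (legendre \<phi> z)"
  have mono: "mono ?T" by (rule convex_deriv_mono[OF \<phi>])
  have D: "(?T has_real_derivative deriv ?T x) (at x)"
    using T[of x] by (simp add: DERIV_deriv_iff_real_differentiable)
  have L: "?L (?T a) = a * ?T a - \<phi> a" for a by (simp add: legendre_at_deriv[OF \<phi>])
  have "(?L has_real_derivative x) (at (?T x))"
    unfolding has_field_derivative_iff LIM_eq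
  proof (intro allI impI)
    fix e :: real assume e: "e > 0"
    define r where "r = e / 2"
    have r: "r > 0" "r < e" using e by (simp_all add: r_def)
    obtain d1 where d1: "d1 > 0" "\<And>h. 0 < h \<Longrightarrow> h < d1 \<Longrightarrow> ?T x < ?T (x + h)"
      using DERIV_pos_inc_right[OF D pos] by auto
    obtain d2 where d2: "d2 > 0" "\<And>h. 0 < h \<Longrightarrow> h < d2 \<Longrightarrow> ?T (x - h) < ?T x"
      using DERIV_pos_inc_left[OF D pos] by auto
    have up: "?T x < ?T (x + r)"
    proof -
      have "?T x < ?T (x + min r (d1 / 2))" using d1 r by (intro d1(2)) auto
      also have "\<dots> \<le> ?T (x + r)" by (intro monoD[OF mono]) auto
      finally show ?thesis .
    qed
    have lo: "?T (x - r) < ?T x"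
    proof -
      have "?T (x - r) \<le> ?T (x - min r (d2 / 2))" by (intro monoD[OF mono]) auto
      also have "\<dots> < ?T x" using d2 r by (intro d2(2)) auto
      finally show ?thesis .
    qed
    show "\<exists>s>0. \<forall>y. y \<noteq> ?T x \<and> norm (y - ?T x) < s \<longrightarrow> norm ((?L y - ?L (?T x)) / (y - ?T x) - x) < e"
    proof (intro exI[of _ "min (?T (x + r) - ?T x) (?T x - ?T (x - r))"] conjI allI impI, goal_cases)
      case 1 show ?case using up lo by simp
    next
      case (2 y)
      hence "?T (x - r) \<le> y" "y \<le> ?T (x + r)" by (auto simp: abs_less_iff)
      moreover have "continuous_on {x - r..x + r} ?T"
        using T by (intro continuous_at_imp_continuous_on ballI differentiable_imp_continuous_within) auto
      ultimately obtain a where a: "x - r \<le> a" "a \<le> x + r" "?T a = y"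
        using IVT'[of ?T "x - r" y "x + r"] r by auto
      have 1: "x * (y - ?T x) \<le> ?L y - ?L (?T x)"
        using convex_tangent[OF \<phi>, of a x] L[of a] L[of x] a(3) by (simp add: algebra_simps)
      have 2: "?L y - ?L (?T x) \<le> a * (y - ?T x)"
        using convex_tangent[OF \<phi>, of x a] L[of a] L[of x] a(3) by (simp add: algebra_simps)
      have ne: "y \<noteq> ?T x" using \<open>y \<noteq> ?T x \<and> _\<close> by simp
      have "\<bar>?L y - ?L (?T x) - x * (y - ?T x)\<bar> \<le> \<bar>(a - x) * (y - ?T x)\<bar>"
        using 1 2 by (simp add: algebra_simps)
      also have "\<dots> \<le> r * \<bar>y - ?T x\<bar>"
        unfolding abs_mult using a by (intro mult_right_mono) auto
      also have "?L y - ?L (?T x) - x * (y - ?T x) = ((?L y - ?L (?T x)) / (y - ?T x) - x) * (y - ?T x)"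
        using ne by (simp add: field_simps)
      finally have "\<bar>(?L y - ?L (?T x)) / (y - ?T x) - x\<bar> \<le> r"
        using ne unfolding abs_mult by simp
      thus ?case using r by simp
    qed
  qed
  thus ?thesis unfolding legendre_deriv_def by (rule DERIV_imp_deriv)
qed

section \<open>The bound on the free moment Stein kernel\<close>

lemma mono_deriv_nonneg:
  fixes T :: "real \<Rightarrow> real"
  assumes "mono T" "T differentiable (at x)"
  shows "0 \<le> deriv T x"
proof (rule ccontr)
  assume n: "\<not> 0 \<le> deriv T x"
  have "(T has_real_derivative deriv T x) (at x)" using assms(2) by (simp add: DERIV_deriv_iff_real_differentiable)
  from DERIV_neg_dec_right[OF this] n obtain d where d: "d > 0" "\<forall>h>0. h < d \<longrightarrow> T (x + h) < T x" by auto
  hence "T (x + d / 2) < T x" by auto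
  with monoD[OF assms(1), of x "x + d / 2"] d(1) show False by auto
qed

lemma C_k_2D:
  assumes "C_k 2 f"
  shows "f differentiable (at x)" "deriv f differentiable (at x)" "continuous_on UNIV (deriv (deriv f))"
proof -
  have "(deriv ^^ 0) f differentiable (at x)" "(deriv ^^ 1) f differentiable (at x)"
    using assms unfolding C_k_def by (metis pos2, metis one_less_numeral_iff semiring_norm(76))
  thus "f differentiable (at x)" "deriv f differentiable (at x)" by simp_all
  show "continuous_on UNIV (deriv (deriv f))" using assms by (simp add: C_k_def numeral_2_eq_2)
qed

lemma C_k_mono:
  assumes "C_k k f" "j \<le> k"
  shows "C_k j f"
proof (cases "j = k")
  case False
  hence "j < k" using assms by simp
  hence "continuous_on UNIV ((deriv ^^ j) f)"
    using assms unfolding C_k_def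
    by (intro continuous_at_imp_continuous_on ballI differentiable_imp_continuous_within) auto
  thus ?thesis using assms by (auto simp: C_k_def)
qed (use assms in simp)


theorem corollary3:
  fixes u \<phi> :: "real \<Rightarrow> real" and \<nu> :: "real measure" and \<epsilon> :: real
  assumes "C_k 2 u"
    and "\<epsilon> > 0"
    and "convex_on UNIV (\<lambda>x. u x - \<epsilon> / 2 * x\<^sup>2)"
    and "is_free_gibbs u \<nu>"
    and "centered \<nu>"
    and "is_free_moment_map \<nu> \<phi>"
    and "C_k 3 \<phi>"
  shows "(SUP (x, y) \<in> measure_support \<nu> \<times> measure_support \<nu>.
            ereal \<bar>free_moment_stein_kernel \<phi> x y\<bar>) \<le> ereal (inverse \<epsilon>)"
proof -
  define T where "T = deriv \<phi>"
  define u' where "u' = deriv u"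
  note u = C_k_2D[OF assms(1)]
  have "C_k 2 \<phi>" using C_k_mono[OF assms(7), of 2] by simp
  note \<phi> = C_k_2D[OF this]
  have cont: "continuous_on UNIV f" if "\<And>x. f differentiable (at x)" for f :: "real \<Rightarrow> real"
    using that by (intro continuous_at_imp_continuous_on ballI differentiable_imp_continuous_within) auto
  have Tcont: "continuous_on UNIV T" and u'cont: "continuous_on UNIV u'"
    unfolding T_def u'_def using \<phi>(2) u(2) by (auto intro!: cont)
  have [measurable]: "T \<in> borel_measurable borel" "u' \<in> borel_measurable borel"
    "u \<in> borel_measurable borel" "\<phi> \<in> borel_measurable borel"
    using Tcont u'cont cont[OF u(1)] cont[OF \<phi>(1)] by (auto intro: borel_measurable_continuous_onI)
  have \<phi>conv: "convex_on UNIV \<phi>" using assms(6) by (simp add: is_free_moment_map_def)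
  have Tmono: "mono T" unfolding T_def by (rule convex_deriv_mono[OF \<phi>conv \<phi>(1)])
  obtain \<eta> where g\<eta>: "is_free_gibbs \<phi> \<eta>" and \<nu>: "\<nu> = distr \<eta> borel T"
    using assms(6) by (auto simp: is_free_moment_map_def T_def)
  have \<eta>: "borel_prob \<eta>" using g\<eta> by (simp add: is_free_gibbs_def)
  interpret prob_space \<eta> using \<eta> by (simp add: borel_prob_def)
  have s\<eta>: "sets \<eta> = sets borel" using \<eta> by (simp add: borel_prob_def)
  have [measurable_cong]: "sets \<eta> = sets borel" by fact
  have sp: "space \<eta> = UNIV" using sets_eq_imp_space_eq[OF s\<eta>] by simp
  interpret P: pair_prob_space \<eta> \<eta> ..
  let ?P = "\<eta> \<Otimes>\<^sub>M \<eta>"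

  let ?w = "\<lambda>x. u x - \<epsilon> / 2 * x\<^sup>2"
  have wd: "(?w has_real_derivative u' x - \<epsilon> * x) (at x)" for x
    unfolding u'_def using u(1)[of x]
    by (auto intro!: derivative_eq_intros simp: DERIV_deriv_iff_real_differentiable)
  have w: "?w differentiable (at x)" "deriv ?w x = u' x - \<epsilon> * x" for x
    using wd[of x] by (auto simp: real_differentiable_def intro: DERIV_imp_deriv)
  have u'mono: "\<epsilon> * (y - x) \<le> u' y - u' x" if "x \<le> y" for x y
    using monoD[OF convex_deriv_mono[OF assms(3) w(1)] that] unfolding w(2) by (simp add: algebra_simps)
  \<comment> \<open>complete the square in the strongly convex lower bound\<close>
  obtain d where ugrowth: "\<And>x. 1 * \<bar>x\<bar> - d \<le> u x"
  proof
    fix x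
    let ?A = "\<bar>u' 0\<bar> + 1"
    have "0 \<le> (\<epsilon> * \<bar>x\<bar> - ?A)\<^sup>2 / (2 * \<epsilon>)" using assms(2) by simp
    also have "\<dots> = \<epsilon> / 2 * x\<^sup>2 - ?A * \<bar>x\<bar> + ?A\<^sup>2 / (2 * \<epsilon>)"
      using assms(2) by (simp add: power2_diff power_mult_distrib field_simps power2_eq_square)
    finally have "?A * \<bar>x\<bar> \<le> \<epsilon> / 2 * x\<^sup>2 + ?A\<^sup>2 / (2 * \<epsilon>)" by simp
    moreover have "- (\<bar>u' 0\<bar> * \<bar>x\<bar>) \<le> u' 0 * x" by (metis abs_mult abs_ge_minus_self minus_le_iff)
    moreover have "u 0 + u' 0 * x \<le> ?w x"
      using convex_tangent[OF assms(3) w(1), of 0 x] unfolding w(2) by simp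
    ultimately show "1 * \<bar>x\<bar> - (?A\<^sup>2 / (2 * \<epsilon>) - u 0) \<le> u x" by (simp add: distrib_right)
  qed
  note I\<nu> = free_gibbs_integrability[OF assms(4) _ zero_less_one ugrowth, simplified]
  obtain R where R: "AE y in \<nu>. \<bar>y\<bar> \<le> R"
    using free_gibbs_bounded_support[OF assms(4) _ zero_less_one ugrowth] by auto
  have offT: "AE p in ?P. T (fst p) \<noteq> T (snd p)"
  proof -
    have "sigma_finite_measure (distr \<eta> borel T)"
      by (intro prob_space_imp_sigma_finite prob_space_distr) simp
    hence eq: "\<nu> \<Otimes>\<^sub>M \<nu> = distr ?P (borel \<Otimes>\<^sub>M borel) (\<lambda>p. (T (fst p), T (snd p)))"
      unfolding \<nu> by (subst pair_measure_distr) (auto simp: case_prod_beta')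
    show ?thesis using I\<nu>(1) unfolding eq by (subst (asm) AE_distr_iff) auto
  qed
  have RT: "AE x in \<eta>. \<bar>T x\<bar> \<le> R" using R unfolding \<nu> by (simp add: AE_distr_iff)
  have Tint: "integrable \<eta> T" using RT by (intro integrable_const_bound[where B = R]) auto
  have T0: "(\<integral>x. T x \<partial>\<eta>) = 0"
    using assms(5) unfolding centered_def \<nu> by (simp add: integral_distr)
  \<comment> \<open>\<open>\<nu>\<close> is not the Dirac mass at \<open>0\<close>, so its barycentre \<open>0\<close> forces \<open>T\<close> to take both signs\<close>
  have sign: "\<not> (AE x in \<eta>. T x = 0)"
  proof
    assume "AE x in \<eta>. T x = 0"
    from AE_pair_coordinates[OF prob_space_axioms this] offT
    have "AE p in ?P. False" by eventually_elim auto
    thus False by simp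
  qed
  obtain p where p: "T p > 0"
  proof (rule ccontr)
    assume "\<not> thesis"
    hence n: "T x \<le> 0" for x using that[of x] by (cases "T x \<le> 0") auto
    have "AE x in \<eta>. - T x = 0"
      using integral_nonneg_eq_0_iff_AE[of \<eta> "\<lambda>x. - T x"] Tint T0 n by simp
    with sign show False by simp
  qed
  obtain q where q: "T q < 0"
  proof (rule ccontr)
    assume "\<not> thesis"
    hence n: "T x \<ge> 0" for x using that[of x] by (cases "T x \<ge> 0") auto
    have "AE x in \<eta>. T x = 0"
      using integral_nonneg_eq_0_iff_AE[of \<eta> T] Tint T0 n by simp
    with sign show False by simp
  qed
  obtain c d' where growth: "c > 0" "\<And>x. c * \<bar>x\<bar> - d' \<le> \<phi> x"
    using convex_linear_growth[OF \<phi>conv \<phi>(1), of p q] p q unfolding T_def by blast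
  note I\<eta> = free_gibbs_integrability[OF g\<eta> _ growth, simplified]
  obtain R\<eta> where R\<eta>: "AE y in \<eta>. \<bar>y\<bar> \<le> R\<eta>"
    using free_gibbs_bounded_support[OF g\<eta> _ growth] by auto
  have id\<eta>: "distr \<eta> borel (\<lambda>x. x) = \<eta>" using distr_id2[OF s\<eta>[symmetric]] by simp
  have fv\<phi>: "first_variation_bound \<eta> (\<lambda>x. x) T"
    using free_gibbs_first_variation[OF g\<eta> I\<eta>(1,2) R\<eta> \<eta> _ id\<eta>[symmetric] \<phi>(1)] Tcont
    unfolding T_def by simp
  have fvu: "first_variation_bound \<eta> T (\<lambda>x. u' (T x))"
    using free_gibbs_first_variation[OF assms(4) I\<nu>(1,2) R \<eta> _ \<nu> u(1)] u'cont
    unfolding u'_def by simp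

  obtain b where b: "\<And>y. \<bar>y\<bar> \<le> R \<Longrightarrow> \<bar>u' y\<bar> \<le> b \<and> \<bar>deriv u' y\<bar> \<le> b"
  proof -
    have "bounded (u' ` {-R..R})" "bounded (deriv u' ` {-R..R})"
      unfolding u'_def using u'cont u(3) by (auto intro!: compact_imp_bounded compact_continuous_image
        intro: continuous_on_subset simp: u'_def)
    then obtain b1 b2 where "\<forall>y\<in>{-R..R}. \<bar>u' y\<bar> \<le> b1" "\<forall>y\<in>{-R..R}. \<bar>deriv u' y\<bar> \<le> b2"
      unfolding bounded_iff by auto
    hence "\<bar>u' y\<bar> \<le> max b1 b2 \<and> \<bar>deriv u' y\<bar> \<le> max b1 b2" if "\<bar>y\<bar> \<le> R" for y
      using that by (auto simp: abs_le_iff le_max_iff_disj)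
    thus thesis by (rule that)
  qed
  have u'int: "integrable \<eta> (\<lambda>x. u' (T x))"
    using RT b by (intro integrable_const_bound[where B = b]) (auto elim!: eventually_mono)

  have swap: "(r - s) * (t - w) = (s - r) * (w - t)" for r s t w :: real by (simp add: algebra_simps)
  \<comment> \<open>strong convexity of \<open>u\<close> makes \<open>u' - y / M\<close> strictly increasing for \<open>M > 1 / \<epsilon>\<close>\<close>
  have upper: "AE p in ?P. \<bar>T (fst p) - T (snd p)\<bar> \<le> M * \<bar>fst p - snd p\<bar>" if M: "M > inverse \<epsilon>" for M
  proof -
    have M0: "M > 0" using M assms(2) by (meson inverse_positive_iff_positive less_trans)
    have Me: "0 < \<epsilon> - 1 / M" using M M0 assms(2) by (simp add: field_simps)
    have str: "0 < ((u' y - y / M) - (u' x - x / M)) * (y - x)" if "x \<noteq> y" for x y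
    proof -
      have *: "0 < ((u' y - y / M) - (u' x - x / M)) * (y - x)" if "x < y" for x y
      proof -
        have "0 < (\<epsilon> - 1 / M) * (y - x)" using Me that by simp
        also have "\<dots> \<le> (u' y - y / M) - (u' x - x / M)"
          using u'mono[of x y] that by (simp add: algebra_simps diff_divide_distrib)
        finally show ?thesis using that by simp
      qed
      show ?thesis
      proof (cases "x < y")
        case False
        hence "0 < ((u' x - x / M) - (u' y - y / M)) * (x - y)" using that by (intro *) simp
        thus ?thesis by (subst swap)
      qed (rule *)
    qed
    show ?thesis
    proof (rule comonotone_comparison[OF prob_space_axioms sp _ _ M0 _ _ fv\<phi> fvu Tint u'int])
      show "T s \<le> T x" if "s < x" for x s using monoD[OF Tmono] that by simp
      show "AE p in ?P. fst p \<noteq> snd p \<and> T (fst p) \<noteq> T (snd p)" using I\<eta>(1) offT by eventually_elim simp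
      show "AE p in ?P. M * \<bar>fst p - snd p\<bar> < \<bar>T (fst p) - T (snd p)\<bar> \<longrightarrow>
          0 < ((u' (T (fst p)) - T (fst p) / M) - (u' (T (snd p)) - T (snd p) / M)) * (T (fst p) - T (snd p))"
        using offT by eventually_elim (auto intro: str)
    qed simp_all
  qed

  define N where "N = \<bar>b\<bar> + 1"
  have N: "N > 0" by (simp add: N_def)
  \<comment> \<open>exchange the roles: \<open>u'\<close> is \<open>b\<close>-Lipschitz on the support of \<open>\<nu>\<close>, so \<open>y - u' y / N\<close> is strictly increasing for \<open>N > b\<close>\<close>
  have lower: "AE p in ?P. \<bar>fst p - snd p\<bar> \<le> N * \<bar>T (fst p) - T (snd p)\<bar>"
  proof (rule comonotone_comparison[OF prob_space_axioms sp _ _ N _ _ fvu fv\<phi> u'int Tint])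
    show "s \<le> x" if "T s < T x" for x s using monoD[OF Tmono, of x s] that by force
    show "AE p in ?P. T (fst p) \<noteq> T (snd p) \<and> fst p \<noteq> snd p" using I\<eta>(1) offT by eventually_elim simp
    show "AE p in ?P. N * \<bar>T (fst p) - T (snd p)\<bar> < \<bar>fst p - snd p\<bar> \<longrightarrow>
        0 < ((T (fst p) - u' (T (fst p)) / N) - (T (snd p) - u' (T (snd p)) / N)) * (fst p - snd p)"
      using offT I\<eta>(1) AE_pair_coordinates[OF prob_space_axioms RT]
    proof eventually_elim
      case (elim p)
      have *: "0 < ((T y - u' (T y) / N) - (T x - u' (T x) / N)) * (y - x)"
        if "x < y" "T x \<noteq> T y" "\<bar>T x\<bar> \<le> R" "\<bar>T y\<bar> \<le> R" for x y
      proof -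
        have lt: "T x < T y" using monoD[OF Tmono, of x y] that by simp
        have "norm (u' (T y) - u' (T x)) \<le> b * norm (T y - T x)"
        proof (rule field_differentiable_bound[where S = "{-R..R}"])
          show "(u' has_field_derivative deriv u' z) (at z within {-R..R})" for z
            using u(2)[of z] unfolding u'_def
            by (auto simp: DERIV_deriv_iff_real_differentiable intro: has_field_derivative_at_within)
          show "norm (deriv u' z) \<le> b" if "z \<in> {-R..R}" for z using b[of z] that by (auto simp: abs_le_iff)
        qed (use that in \<open>auto simp: abs_le_iff\<close>)
        also have "\<dots> < N * (T y - T x)" using lt by (simp add: N_def)
        finally have "(u' (T y) - u' (T x)) / N < T y - T x" using N by (simp add: field_simps)
        hence "0 < (T y - u' (T y) / N) - (T x - u' (T x) / N)" by (simp add: diff_divide_distrib)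
        thus ?thesis using that by simp
      qed
      show ?case
      proof (cases "snd p < fst p")
        case True
        thus ?thesis using *[of "snd p" "fst p"] elim by simp
      next
        case False
        hence "fst p < snd p" using elim by simp
        thus ?thesis using *[of "fst p" "snd p"] elim by (subst swap) simp
      qed
    qed
  qed simp_all

  have slope: "AE p in ?P. \<bar>T (fst p) - T (snd p)\<bar> \<in> (\<lambda>c. c * \<bar>fst p - snd p\<bar>) ` {1 / N..M}"
    if M: "M > inverse \<epsilon>" for M
    using upper[OF M] lower I\<eta>(1)
  proof eventually_elim
    case (elim p)
    thus ?case using N
      by (intro image_eqI[of _ _ "\<bar>T (fst p) - T (snd p)\<bar> / \<bar>fst p - snd p\<bar>"])
        (auto simp: pos_le_divide_eq pos_divide_le_eq divide_simps mult.commute)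
  qed
  have dT: "1 / N \<le> deriv T x" "deriv T x \<le> M" if x: "x \<in> measure_support \<eta>" and M: "M > inverse \<epsilon>" for x M
  proof -
    have "\<bar>deriv T x\<bar> \<in> {1 / N..M}"
      by (rule deriv_on_measure_support[OF \<eta> _ _ I\<eta>(1) slope[OF M] _ x]) (use \<phi> in \<open>auto simp: T_def\<close>)
    moreover have "0 \<le> deriv T x" using \<phi>(2) by (intro mono_deriv_nonneg[OF Tmono]) (simp add: T_def)
    ultimately show "1 / N \<le> deriv T x" "deriv T x \<le> M" by auto
  qed
  have leg: "legendre_deriv \<phi> (T x) = x" if x: "x \<in> measure_support \<eta>" for x
  proof -
    have "0 < 1 / N" using N by simp
    also have "\<dots> \<le> deriv T x" by (rule dT(1)[OF x, of "inverse \<epsilon> + 1"]) simp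
    finally show ?thesis unfolding T_def by (intro legendre_deriv_at_deriv \<phi>conv \<phi>)
  qed
  have bound: "\<bar>free_diff_quotient T x y\<bar> \<le> M"
    if x: "x \<in> measure_support \<eta>" and y: "y \<in> measure_support \<eta>" and M: "M > inverse \<epsilon>" for x y M
  proof (cases "x = y")
    case True
    have "0 \<le> 1 / N" using N by simp
    hence "0 \<le> deriv T x" using dT(1)[OF x M] by (rule order_trans)
    with dT(2)[OF x M] True show ?thesis by (simp add: free_diff_quotient_def)
  next
    case False
    have "closed {p. \<bar>T (fst p) - T (snd p)\<bar> \<le> M * \<bar>fst p - snd p\<bar>}"
      by (intro closed_Collect_le continuous_intros continuous_on_compose2[OF Tcont]) auto
    from measure_support_pair_in_closed[OF \<eta> _ this x y] upper[OF M]
    have "\<bar>T x - T y\<bar> \<le> M * \<bar>x - y\<bar>" by simp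
    with False show ?thesis by (simp add: free_diff_quotient_def abs_divide pos_divide_le_eq)
  qed
  show ?thesis
  proof (rule SUP_least, clarify)
    fix x y assume xy: "x \<in> measure_support \<nu>" "y \<in> measure_support \<nu>"
    obtain a where a: "a \<in> measure_support \<eta>" "T a = x"
      using measure_support_distr_subset[OF \<eta> R\<eta> Tcont] xy(1) unfolding \<nu> by blast
    obtain b where b: "b \<in> measure_support \<eta>" "T b = y"
      using measure_support_distr_subset[OF \<eta> R\<eta> Tcont] xy(2) unfolding \<nu> by blast
    have "free_moment_stein_kernel \<phi> x y = free_diff_quotient T a b"
      using leg[OF a(1)] leg[OF b(1)] a b by (simp add: free_moment_stein_kernel_def T_def)
    moreover have "\<bar>free_diff_quotient T a b\<bar> \<le> inverse \<epsilon>"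
      by (rule dense_ge) (rule bound[OF a(1) b(1)])
    ultimately show "ereal \<bar>free_moment_stein_kernel \<phi> x y\<bar> \<le> ereal (inverse \<epsilon>)" by simp
  qed
qed

end
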